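(* Consider the problem $$\min_{x\in\mathbb R^n}\ F(x)\equiv f(x)+g(x)+h_1(A_1x)\quad\text{s.t.}\quad A_2x\in\mathcal K,$$ with $A_1\in\mathbb R^{d_1\times n}$, $A_2\in\mathbb R^{d_2\times n}$, $A=\begin{pmatrix} A_1 \\ A_2 \end{pmatrix}$, under the standing assumptions in the context, and assume that there is $L_f>0$ such that $$f(y)-f(x)-\langle\nabla f(x),y-x\rangle\le\frac{L_f}2\|x-y\|^2,\qquad\forall x,y\in\operatorname{dom}(g).$$ Let $\mu_g\ge0$ be the strong convexity parameter of $g$. Apply Algorithm IPALM($\mathcal A$) (described in the context) with $\eta<\rho$ and with the accelerated proximal gradient method (APG) as inner solver $\mathcal A$. Then to obtain a solution $x^s$ with $|\mathbb E[F(x^s)-F^\star]|\le\epsilon$ and $\mathbb E[\operatorname{dist}(A_2x^s,\mathcal K)]\le\epsilon$, the expected number of APG iterations is bounded by $$\begin{cases}\tilde O\left(\dfrac{\sqrt{L_f\beta_0+\|A\|^2}+\sqrt{\mu_g}}{\sqrt{\mu_g\epsilon}}\right)&\text{if }\mu_g>0,\\[3mm] \tilde O\left(\dfrac{\sqrt{L_f\beta_0+\|A\|^2}}{\epsilon}\right)&\text{if }\mu_g=0.\end{cases}$$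
   Context: Setting. Let $d=d_1+d_2$; for $\lambda\in\mathbb R^d$ write $\lambda=(\lambda_1;\lambda_2)$ with $\lambda_i\in\mathbb R^{d_i}$. $\|\cdot\|$ is the Euclidean norm for vectors and the spectral norm for matrices. $g:\mathbb R^n\to\mathbb R\cup\{+\infty\}$ and $h_1:\mathbb R^{d_1}\to\mathbb R$ are proper, convex, closed; $h_2$ is the indicator function of a nonempty closed convex set $\mathcal K\subset\mathbb R^{d_2}$; $f:\mathbb R^n\to\mathbb R\cup\{+\infty\}$ is convex and differentiable on an open set containing $\operatorname{dom}(g)$. Put $p(x)=Ax$, $h(u)=h_1(u_1)+h_2(u_2)$, $h^*$ the Fenchel conjugate; $F^\star$ is the optimal value of the problem; $L(x;\lambda)=f(x)+g(x)+\langle\lambda,p(x)\rangle-h^*(\lambda)$, $D(\lambda)=\inf_xL(x;\lambda)$. Standing assumptions: $h_1$ is $L_{h_1}$-Lipschitz; the primal problem and the dual problem $\max_\lambda D(\lambda)$ have optimal solutions and strong duality holds: there are $x^\star\in\operatorname{dom}(g)$, $\lambda^\star\in\operatorname{dom}(h^* )$ with $A_2x^\star\in\mathcal K$ and $F(x^\star)=L(x^\star;\lambda^\star)=D(\lambda^\star)$. Below $x^\star,\lambda^\star$ are arbitrary primal and dual optimal solutions. Smoothing. For $u,\lambda\in\mathbb R^d$, $\beta>0$: $h(u;\lambda,\beta)=\max_v\{\langle v,u\rangle-h^*(v)-\frac\beta2\|v-\lambda\|^2\}$, $\Lambda(u;\lambda,\beta)$ is its unique maximizer, and $L(x;y,\lambda,\beta)=f(x)+g(x)+h(p(x);\lambda,\beta)+\frac\beta2\|x-y\|^2$.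 Algorithm IPALM($\mathcal A$). Parameters $\beta_0>0$, $\rho\in(1/2,1)$, $\eta\in(0,1)$, positive integer $m_0$; initial (deterministic) $x^{-1}\in\operatorname{dom}(g)$, $\lambda^0\in\operatorname{dom}(h^* )$. Write $H_s(x)=L(x;x^{s-1},\lambda^s,\beta_s)$, $H_s^\star=\min_xH_s(x)$, $\beta_s=\beta_0\rho^s$, $\epsilon_s=\epsilon_0\eta^s$. Set $x^0=\mathcal A(x^{-1},m_0,H_0)$ and let $\epsilon_0>0$ be a constant with $\epsilon_0\ge H_0(x^0)-H_0^\star$. For $s=0,1,2,\dots$: $\lambda^{s+1}=\Lambda(p(x^s);\lambda^s,\beta_s)$; $m_{s+1}$ is the smallest positive integer such that $2\epsilon_s+M_s\le 2^{\lfloor m_{s+1}/K_{s+1}\rfloor}\epsilon_{s+1}/2$; $x^{s+1}=\mathcal A(x^s,m_{s+1},H_{s+1})$. Here $$M_s=\beta_s\|\lambda^{s+1}-\lambda^s\|^2+\tfrac{\beta_s-\beta_{s+1}}2\|\Lambda(p(x^s);\lambda^{s+1},\beta_{s+1})-\lambda^{s+1}\|^2+\tfrac{\beta_s^2}{2\beta_{s+1}-\beta_s}\|x^{s-1}-x^s\|^2$$ $$\qquad+\|\lambda^{s+1}-\lambda^s\|\sqrt{\left((\beta_s+\beta_{s+1})L_{h_1}+\|\beta_s\lambda_1^s-\beta_{s+1}\lambda_1^{s+1}\|\right)^2+\|\beta_s\lambda_2^s-\beta_{s+1}\lambda_2^{s+1}\|^2}.$$ $\mathcal A(x,k,H_s)$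 denotes the output of $k$ iterations of $\mathcal A$ on $\min H_s$ started at $x$. Inner solver guarantee (known convergence result, taken as given). APG (with restart), applied to $H_s$ split as the smooth part $f(x)+h(Ax;\lambda^s,\beta_s)$ plus $g(x)+\frac{\beta_s}2\|x-x^{s-1}\|^2$, satisfies $H_s(\mathcal A(x,k,H_s))-H_s^\star\le2^{-\lfloor k/K_s\rfloor}(H_s(x)-H_s^\star)$ for all $x\in\operatorname{dom}(g)$ and $k$, with a deterministic $K_s\ge1$ satisfying $K_s\le2\sqrt{\frac{2(L_f+\beta_s^{-1}\|A\|^2)}{\mu_g+\beta_s}}+1$; this $K_s$ is used in the algorithm. Convention for $\tilde O$. Let $c_0=2\left(\|(x^{-1},\lambda^0)-(x^\star,\lambda^\star)\|+\frac{2\sqrt{\epsilon_0/\beta_0}}{1-\sqrt{\eta/\rho}}\right)^2+2\|\lambda^\star\|^2+2\|x^\star\|^2$, $c_1=\max(\epsilon_0+2L_{h_1}^2\beta_0+c_0\beta_0,\beta_0\|\lambda_2^\star\|\sqrt{c_0},\beta_0\sqrt{c_0})$, $c_2=\log_2\left(\frac4\eta+\frac{2\beta_0((11+2\rho^{-2})(L_{h_1}^2+4c_0)+4(2\rho-1)^{-1}c_0)}{\epsilon_0\eta}\right)+1$. $\tilde O$ hides logarithmic terms and constants depending only on the order in $1/\epsilon$ and on $c_1,c_2,\rho,\eta,\beta_0,\epsilon_0,m_0$: "bounded by $\tilde O(q(\epsilon))$" means there are $C,k>0$ depending only on these quantities such that, for all sufficiently small $\epsilon>0$, some $s$ with the required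 accuracy satisfies $\sum_{t=0}^s\mathbb E[m_t]\le C\,q(\epsilon)\,(1+\ln(1/\epsilon))^k$. *)

theory Defs
  imports "HOL-Probability.Probability"
begin

section \<open>Euclidean spaces of varying dimension\<close>

text \<open>
  The constants in the complexity bound must not depend on the dimensions, so the dimensions have
  to be quantified inside the statement and cannot be types. All spaces are therefore realised in
  one inner product space, the finitely supported real sequences with the Euclidean norm, and
  \<open>euclid n\<close> below is the n-dimensional Euclidean space given by the coordinates \<open>0, \<dots>, n - 1\<close>.
  (The norm that the Analysis library puts on finitely supported functions, \<open>poly_mapping\<close>, is the
  sum norm, hence the new type.)
\<close>

typedef rvec = "{x :: nat \<Rightarrow> real. finite {i. x i \<noteq> 0}}"
  morphisms coord Abs_rvec
  by (rule exI[of _ "\<lambda>_. 0"]) simp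

setup_lifting type_definition_rvec

lemma rvec_eqI: "(\<And>i. coord x i = coord y i) \<Longrightarrow> x = y"
  by (simp add: coord_inject[symmetric] fun_eq_iff)

lemma finite_coord: "finite {i. coord x i \<noteq> 0}"
  using coord[of x] by simp

instantiation rvec :: real_inner
begin

lift_definition zero_rvec :: rvec is "\<lambda>_. 0" by simp

lift_definition plus_rvec :: "rvec \<Rightarrow> rvec \<Rightarrow> rvec" is "\<lambda>x y i. x i + y i"
  by (erule (1) finite_subset[OF _ finite_UnI, rotated]) auto

lift_definition minus_rvec :: "rvec \<Rightarrow> rvec \<Rightarrow> rvec" is "\<lambda>x y i. x i - y i"
  by (erule (1) finite_subset[OF _ finite_UnI, rotated]) auto

lift_definition uminus_rvec :: "rvec \<Rightarrow> rvec" is "\<lambda>x i. - x i" by simp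

lift_definition scaleR_rvec :: "real \<Rightarrow> rvec \<Rightarrow> rvec" is "\<lambda>r x i. r * x i"
  by (erule finite_subset[rotated]) auto

definition inner_rvec :: "rvec \<Rightarrow> rvec \<Rightarrow> real"
  where "inner_rvec x y = (\<Sum>i | coord x i \<noteq> 0. coord x i * coord y i)"

definition norm_rvec :: "rvec \<Rightarrow> real" where "norm_rvec x = sqrt (inner x x)"

definition sgn_rvec :: "rvec \<Rightarrow> rvec" where "sgn_rvec x = inverse (norm x) *\<^sub>R x"

definition dist_rvec :: "rvec \<Rightarrow> rvec \<Rightarrow> real" where "dist_rvec x y = norm (x - y)"

definition uniformity_rvec :: "(rvec \<times> rvec) filter"
  where "uniformity_rvec = (INF e\<in>{0<..}. principal {(x, y). dist x y < e})"

definition open_rvec :: "rvec set \<Rightarrow> bool"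
  where "open_rvec U \<longleftrightarrow> (\<forall>x\<in>U. \<forall>\<^sub>F (x', y) in uniformity. x' = x \<longrightarrow> y \<in> U)"

lemma inner_rvec_superset:
  assumes "finite S" "{i. coord x i \<noteq> 0} \<subseteq> S"
  shows "inner x y = (\<Sum>i\<in>S. coord x i * coord y i)"
  unfolding inner_rvec_def using assms by (intro sum.mono_neutral_left) auto

instance
proof
  fix a b c :: rvec and r s :: real
  show "a + b + c = a + (b + c)" "a + b = b + a" "0 + a = a" "- a + a = 0" "a - b = a + - b"
    by (rule rvec_eqI; transfer; simp)+
  show "r *\<^sub>R (a + b) = r *\<^sub>R a + r *\<^sub>R b" "(r + s) *\<^sub>R a = r *\<^sub>R a + s *\<^sub>R a"
    "r *\<^sub>R s *\<^sub>R a = (r * s) *\<^sub>R a" "1 *\<^sub>R a = a"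
    by (rule rvec_eqI; transfer; simp add: algebra_simps)+
  show "sgn a = inverse (norm a) *\<^sub>R a" "dist a b = norm (a - b)" "norm a = sqrt (inner a a)"
    by (simp_all add: sgn_rvec_def dist_rvec_def norm_rvec_def)
  show "uniformity = (INF e\<in>{0<..}. principal {(x, y :: rvec). dist x y < e})"
    by (rule uniformity_rvec_def)
  show "open U \<longleftrightarrow> (\<forall>x\<in>U. \<forall>\<^sub>F (x', y) in uniformity. x' = x \<longrightarrow> y \<in> U)" for U :: "rvec set"
    by (rule open_rvec_def)
  let ?S = "{i. coord a i \<noteq> 0} \<union> {i. coord b i \<noteq> 0}"
  have fin: "finite ?S" by (simp add: finite_coord)
  have plus: "coord (a + b) i = coord a i + coord b i" for i by transfer simp
  have scale: "coord (r *\<^sub>R a) i = r * coord a i" for i by transfer simp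
  show "inner a b = inner b a"
    by (subst (1 2) inner_rvec_superset[OF fin]) (auto simp: mult.commute)
  show "inner (a + b) c = inner a c + inner b c"
    by (subst (1 2 3) inner_rvec_superset[OF fin])
       (auto simp: plus sum.distrib[symmetric] algebra_simps)
  show "inner (r *\<^sub>R a) b = r * inner a b"
    by (subst (1 2) inner_rvec_superset[OF fin])
       (auto simp: scale sum_distrib_left algebra_simps)
  show "0 \<le> inner a a" by (simp add: inner_rvec_def sum_nonneg)
  have "inner a a = 0 \<longleftrightarrow> (\<forall>i\<in>{i. coord a i \<noteq> 0}. coord a i * coord a i = 0)"
    unfolding inner_rvec_def by (rule sum_nonneg_eq_0_iff) (auto simp: finite_coord)
  also have "\<dots> \<longleftrightarrow> a = 0"
    by (auto intro!: rvec_eqI simp: zero_rvec.rep_eq)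
  finally show "inner a a = 0 \<longleftrightarrow> a = 0" .
qed

end

definition euclid :: "nat \<Rightarrow> rvec set"
  where "euclid n = {x. \<forall>i\<ge>n. coord x i = 0}"

text \<open>The vector \<open>B x\<close> for an \<open>m \<times> n\<close> matrix \<open>B\<close>; entries outside that range are ignored.\<close>

lift_definition mat_vec :: "nat \<Rightarrow> nat \<Rightarrow> (nat \<Rightarrow> nat \<Rightarrow> real) \<Rightarrow> rvec \<Rightarrow> rvec"
  is "\<lambda>m n B x i. if i < m then \<Sum>j<n. B i j * x j else 0"
  by (rule finite_subset[of _ "{..<_}"]) auto


section \<open>Extended-valued convex functions\<close>

definition epi_on :: "'a set \<Rightarrow> ('a \<Rightarrow> ereal) \<Rightarrow> ('a \<times> real) set"
  where "epi_on S \<phi> = {(x, r). x \<in> S \<and> \<phi> x \<le> ereal r}"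

definition edom :: "'a set \<Rightarrow> ('a \<Rightarrow> ereal) \<Rightarrow> 'a set"
  where "edom S \<phi> = {x \<in> S. \<phi> x < \<infinity>}"

definition proper_on :: "'a set \<Rightarrow> ('a \<Rightarrow> ereal) \<Rightarrow> bool"
  where "proper_on S \<phi> \<longleftrightarrow> (\<forall>x\<in>S. \<phi> x \<noteq> -\<infinity>) \<and> edom S \<phi> \<noteq> {}"

definition convex_fun_on :: "'a::real_vector set \<Rightarrow> ('a \<Rightarrow> ereal) \<Rightarrow> bool"
  where "convex_fun_on S \<phi> \<longleftrightarrow> convex (epi_on S \<phi>)"

definition closed_fun_on :: "'a::topological_space set \<Rightarrow> ('a \<Rightarrow> ereal) \<Rightarrow> bool"
  where "closed_fun_on S \<phi> \<longleftrightarrow> closed (epi_on S \<phi>)"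

definition strongly_convex_on :: "'a::real_normed_vector set \<Rightarrow> real \<Rightarrow> ('a \<Rightarrow> ereal) \<Rightarrow> bool"
  where "strongly_convex_on S \<mu> \<phi> \<longleftrightarrow>
    (\<forall>x\<in>S. \<forall>y\<in>S. \<forall>t\<in>{0..1}.
       \<phi> ((1 - t) *\<^sub>R x + t *\<^sub>R y)
         \<le> ereal (1 - t) * \<phi> x + ereal t * \<phi> y - ereal (\<mu> / 2 * t * (1 - t) * (norm (x - y))\<^sup>2))"

definition conj_on :: "'a::real_inner set \<Rightarrow> ('a \<Rightarrow> ereal) \<Rightarrow> 'a \<Rightarrow> ereal"
  where "conj_on S \<phi> y = (SUP u\<in>S. ereal (inner y u) - \<phi> u)"

definition set_indicator :: "'a set \<Rightarrow> 'a \<Rightarrow> ereal"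
  where "set_indicator K u = (if u \<in> K then 0 else \<infinity>)"

definition gradient_on :: "rvec set \<Rightarrow> (rvec \<Rightarrow> ereal) \<Rightarrow> rvec \<Rightarrow> rvec"
  where "gradient_on S \<phi> x = (THE v. v \<in> S \<and>
    ((\<lambda>z. real_of_ereal (\<phi> z)) has_derivative (\<lambda>d. inner v d)) (at x within S))"


section \<open>The problem and its dual\<close>

text \<open>
  A vector \<open>\<lambda> = (\<lambda>\<^sub>1; \<lambda>\<^sub>2)\<close> with blocks of sizes \<open>d\<^sub>1\<close> and \<open>d\<^sub>2\<close> is a pair; the norm and the inner
  product on pairs are the Euclidean ones of the stacked vector.
\<close>

record problem =
  xdim :: nat
  dim1 :: nat
  dim2 :: nat
  f_of :: "rvec \<Rightarrow> ereal"
  g_of :: "rvec \<Rightarrow> ereal"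
  h1_of :: "rvec \<Rightarrow> real"
  K_of :: "rvec set"
  A1_of :: "nat \<Rightarrow> nat \<Rightarrow> real"
  A2_of :: "nat \<Rightarrow> nat \<Rightarrow> real"

definition X_of :: "problem \<Rightarrow> rvec set"
  where "X_of P = euclid (xdim P)"

definition Y_of :: "problem \<Rightarrow> (rvec \<times> rvec) set"
  where "Y_of P = euclid (dim1 P) \<times> euclid (dim2 P)"

definition dom_g :: "problem \<Rightarrow> rvec set"
  where "dom_g P = edom (X_of P) (g_of P)"

definition mul_A1 :: "problem \<Rightarrow> rvec \<Rightarrow> rvec"
  where "mul_A1 P = mat_vec (dim1 P) (xdim P) (A1_of P)"

definition mul_A2 :: "problem \<Rightarrow> rvec \<Rightarrow> rvec"
  where "mul_A2 P = mat_vec (dim2 P) (xdim P) (A2_of P)"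

definition mul_A :: "problem \<Rightarrow> rvec \<Rightarrow> rvec \<times> rvec"
  where "mul_A P x = (mul_A1 P x, mul_A2 P x)"

text \<open>Since \<open>mul_A P\<close> only reads the first \<open>xdim P\<close> coordinates, this is the spectral norm of \<open>A\<close>.\<close>

definition normA :: "problem \<Rightarrow> real"
  where "normA P = onorm (mul_A P)"

definition h_sum :: "problem \<Rightarrow> rvec \<times> rvec \<Rightarrow> ereal"
  where "h_sum P u = ereal (h1_of P (fst u)) + set_indicator (K_of P) (snd u)"

definition hconj :: "problem \<Rightarrow> rvec \<times> rvec \<Rightarrow> ereal"
  where "hconj P = conj_on (Y_of P) (h_sum P)"

definition dom_hconj :: "problem \<Rightarrow> (rvec \<times> rvec) set"
  where "dom_hconj P = edom (Y_of P) (hconj P)"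

definition objective :: "problem \<Rightarrow> rvec \<Rightarrow> ereal"
  where "objective P x = f_of P x + g_of P x + ereal (h1_of P (mul_A1 P x))"

definition feasible :: "problem \<Rightarrow> rvec set"
  where "feasible P = {x \<in> X_of P. mul_A2 P x \<in> K_of P}"

definition opt_value :: "problem \<Rightarrow> ereal"
  where "opt_value P = (INF x\<in>feasible P. objective P x)"

text \<open>
  For \<open>f x + g x = \<infinity>\<close> the value is \<open>\<infinity>\<close> whatever \<open>\<lambda>\<close> is, by the library convention
  \<open>\<infinity> - \<infinity> = \<infinity>\<close>; hence \<open>dual_fun P \<lambda> = -\<infinity>\<close> outside \<open>dom_hconj P\<close>, as it should be.
\<close>

definition lagr :: "problem \<Rightarrow> rvec \<Rightarrow> rvec \<times> rvec \<Rightarrow> ereal"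
  where "lagr P x l = f_of P x + g_of P x + ereal (inner l (mul_A P x)) - hconj P l"

definition dual_fun :: "problem \<Rightarrow> rvec \<times> rvec \<Rightarrow> ereal"
  where "dual_fun P l = (INF x\<in>X_of P. lagr P x l)"

definition primal_optimal :: "problem \<Rightarrow> rvec \<Rightarrow> bool"
  where "primal_optimal P x \<longleftrightarrow> x \<in> feasible P \<and> objective P x = opt_value P"

definition dual_optimal :: "problem \<Rightarrow> rvec \<times> rvec \<Rightarrow> bool"
  where "dual_optimal P l \<longleftrightarrow> l \<in> Y_of P \<and> dual_fun P l = (SUP k\<in>Y_of P. dual_fun P k)"

definition f_assms :: "problem \<Rightarrow> bool"
  where "f_assms P \<longleftrightarrow>
    (\<forall>x\<in>X_of P. f_of P x \<noteq> -\<infinity>) \<and> convex_fun_on (X_of P) (f_of P) \<and>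
    (\<exists>U. openin (top_of_set (X_of P)) U \<and> dom_g P \<subseteq> U \<and>
         (\<forall>x\<in>U. f_of P x < \<infinity> \<and>
            (\<lambda>z. real_of_ereal (f_of P z)) differentiable (at x within X_of P)))"

definition standing_assms :: "problem \<Rightarrow> real \<Rightarrow> bool"
  where "standing_assms P Lh1 \<longleftrightarrow>
    f_assms P \<and>
    proper_on (X_of P) (g_of P) \<and> convex_fun_on (X_of P) (g_of P) \<and> closed_fun_on (X_of P) (g_of P) \<and>
    proper_on (euclid (dim1 P)) (\<lambda>u. ereal (h1_of P u)) \<and>
    convex_fun_on (euclid (dim1 P)) (\<lambda>u. ereal (h1_of P u)) \<and>
    closed_fun_on (euclid (dim1 P)) (\<lambda>u. ereal (h1_of P u)) \<and>
    Lh1-lipschitz_on (euclid (dim1 P)) (h1_of P) \<and>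
    K_of P \<subseteq> euclid (dim2 P) \<and> K_of P \<noteq> {} \<and> convex (K_of P) \<and> closed (K_of P) \<and>
    (\<exists>x l. x \<in> dom_g P \<and> l \<in> dom_hconj P \<and> mul_A2 P x \<in> K_of P \<and>
       primal_optimal P x \<and> dual_optimal P l \<and>
       objective P x = lagr P x l \<and> lagr P x l = dual_fun P l)"

definition quadratic_upper_bound :: "problem \<Rightarrow> real \<Rightarrow> bool"
  where "quadratic_upper_bound P Lf \<longleftrightarrow>
    (\<forall>x\<in>dom_g P. \<forall>y\<in>dom_g P.
       f_of P y - f_of P x - ereal (inner (gradient_on (X_of P) (f_of P) x) (y - x))
         \<le> ereal (Lf / 2 * (norm (x - y))\<^sup>2))"


section \<open>Smoothing\<close>

definition smooth_obj ::
  "problem \<Rightarrow> rvec \<times> rvec \<Rightarrow> rvec \<times> rvec \<Rightarrow> real \<Rightarrow> rvec \<times> rvec \<Rightarrow> ereal"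
  where "smooth_obj P u l \<beta> v = ereal (inner v u) - hconj P v - ereal (\<beta> / 2 * (norm (v - l))\<^sup>2)"

definition h_smooth :: "problem \<Rightarrow> rvec \<times> rvec \<Rightarrow> rvec \<times> rvec \<Rightarrow> real \<Rightarrow> ereal"
  where "h_smooth P u l \<beta> = (SUP v\<in>Y_of P. smooth_obj P u l \<beta> v)"

definition Lam :: "problem \<Rightarrow> rvec \<times> rvec \<Rightarrow> rvec \<times> rvec \<Rightarrow> real \<Rightarrow> rvec \<times> rvec"
  where "Lam P u l \<beta> = (THE v. is_arg_max (smooth_obj P u l \<beta>) (\<lambda>v. v \<in> Y_of P) v)"

definition lagr_smooth ::
  "problem \<Rightarrow> rvec \<Rightarrow> rvec \<Rightarrow> rvec \<times> rvec \<Rightarrow> real \<Rightarrow> ereal"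
  where "lagr_smooth P x y l \<beta> =
    f_of P x + g_of P x + h_smooth P (mul_A P x) l \<beta> + ereal (\<beta> / 2 * (norm (x - y))\<^sup>2)"


section \<open>The algorithm\<close>

text \<open>
  The iterate \<open>x s\<close> is indexed by \<open>s \<ge> 0\<close> and the starting point (index \<open>-1\<close>) is kept separately;
  \<open>prev_iterate xi x s\<close> is the iterate with index \<open>s - 1\<close>.
\<close>

definition prev_iterate :: "rvec \<Rightarrow> (nat \<Rightarrow> rvec) \<Rightarrow> nat \<Rightarrow> rvec"
  where "prev_iterate xi x s = (case s of 0 \<Rightarrow> xi | Suc t \<Rightarrow> x t)"

definition subproblem ::
  "problem \<Rightarrow> (nat \<Rightarrow> real) \<Rightarrow> rvec \<Rightarrow> (nat \<Rightarrow> rvec) \<Rightarrow> (nat \<Rightarrow> rvec \<times> rvec) \<Rightarrow> nat \<Rightarrow> rvec \<Rightarrow> ereal"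
  where "subproblem P \<beta> xi x l s z = lagr_smooth P z (prev_iterate xi x s) (l s) (\<beta> s)"

definition subproblem_opt ::
  "problem \<Rightarrow> (nat \<Rightarrow> real) \<Rightarrow> rvec \<Rightarrow> (nat \<Rightarrow> rvec) \<Rightarrow> (nat \<Rightarrow> rvec \<times> rvec) \<Rightarrow> nat \<Rightarrow> ereal"
  where "subproblem_opt P \<beta> xi x l s = (INF z\<in>X_of P. subproblem P \<beta> xi x l s z)"

definition M_term ::
  "problem \<Rightarrow> real \<Rightarrow> (nat \<Rightarrow> real) \<Rightarrow> rvec \<Rightarrow> (nat \<Rightarrow> rvec) \<Rightarrow> (nat \<Rightarrow> rvec \<times> rvec) \<Rightarrow> nat \<Rightarrow> real"
  where "M_term P Lh1 \<beta> xi x l s =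
    \<beta> s * (norm (l (Suc s) - l s))\<^sup>2
    + (\<beta> s - \<beta> (Suc s)) / 2
        * (norm (Lam P (mul_A P (x s)) (l (Suc s)) (\<beta> (Suc s)) - l (Suc s)))\<^sup>2
    + (\<beta> s)\<^sup>2 / (2 * \<beta> (Suc s) - \<beta> s) * (norm (prev_iterate xi x s - x s))\<^sup>2
    + norm (l (Suc s) - l s)
        * sqrt (((\<beta> s + \<beta> (Suc s)) * Lh1
                  + norm (\<beta> s *\<^sub>R fst (l s) - \<beta> (Suc s) *\<^sub>R fst (l (Suc s))))\<^sup>2
                + (norm (\<beta> s *\<^sub>R snd (l s) - \<beta> (Suc s) *\<^sub>R snd (l (Suc s))))\<^sup>2)"

type_synonym solver = "rvec \<Rightarrow> nat \<Rightarrow> (rvec \<Rightarrow> ereal) \<Rightarrow> rvec"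

text \<open>
  One run of the method. The arguments of the solver \<open>\<A>\<close> are the starting point, the number of
  inner iterations and the objective; \<open>\<kappa> s\<close> is the constant \<open>K\<close> with index \<open>s\<close>, and
  \<open>m s\<close> is the number of inner iterations spent on computing \<open>x s\<close>.
\<close>

definition ipalm_run ::
  "problem \<Rightarrow> real \<Rightarrow> solver \<Rightarrow> (nat \<Rightarrow> real) \<Rightarrow> real \<Rightarrow> real \<Rightarrow> real \<Rightarrow> real \<Rightarrow> nat \<Rightarrow>
   rvec \<Rightarrow> rvec \<times> rvec \<Rightarrow> (nat \<Rightarrow> rvec) \<Rightarrow> (nat \<Rightarrow> rvec \<times> rvec) \<Rightarrow> (nat \<Rightarrow> nat) \<Rightarrow> bool"
  where "ipalm_run P Lh1 \<A> \<kappa> \<beta>0 \<rho> \<epsilon>0 \<eta> m0 xi li x l m \<longleftrightarrow>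
    (let \<beta> = (\<lambda>s. \<beta>0 * \<rho> ^ s);
         e = (\<lambda>s. \<epsilon>0 * \<eta> ^ s);
         H = subproblem P \<beta> xi x l;
         Hopt = subproblem_opt P \<beta> xi x l
     in l 0 = li \<and> m 0 = m0 \<and>
        (\<forall>s. x s = \<A> (prev_iterate xi x s) (m s) (H s)) \<and>
        H 0 (x 0) - Hopt 0 \<le> ereal \<epsilon>0 \<and>
        (\<forall>s. l (Suc s) = Lam P (mul_A P (x s)) (l s) (\<beta> s)) \<and>
        (\<forall>s. m (Suc s) = (LEAST k. 0 < k \<and>
           2 * e s + M_term P Lh1 \<beta> xi x l s
             \<le> 2 powi \<lfloor>real k / \<kappa> (Suc s)\<rfloor> * e (Suc s) / 2)))"

text \<open>
  The convergence guarantee of the (restarted) accelerated proximal gradient method on the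
  subproblems of a run, which is all that is required of the inner solver.
\<close>

definition apg_guarantee ::
  "problem \<Rightarrow> real \<Rightarrow> real \<Rightarrow> solver \<Rightarrow> (nat \<Rightarrow> real) \<Rightarrow> real \<Rightarrow> real \<Rightarrow>
   rvec \<Rightarrow> (nat \<Rightarrow> rvec) \<Rightarrow> (nat \<Rightarrow> rvec \<times> rvec) \<Rightarrow> bool"
  where "apg_guarantee P Lf \<mu>g \<A> \<kappa> \<beta>0 \<rho> xi x l \<longleftrightarrow>
    (let \<beta> = (\<lambda>s. \<beta>0 * \<rho> ^ s);
         H = subproblem P \<beta> xi x l;
         Hopt = subproblem_opt P \<beta> xi x l
     in (\<forall>s. 1 \<le> \<kappa> s \<and> \<kappa> s \<le> 2 * sqrt (2 * (Lf + (normA P)\<^sup>2 / \<beta> s) / (\<mu>g + \<beta> s)) + 1) \<and>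
        (\<forall>s. \<forall>z\<in>dom_g P. \<forall>k.
           \<A> z k (H s) \<in> X_of P \<and>
           H s (\<A> z k (H s)) - Hopt s
             \<le> ereal (2 powi (- \<lfloor>real k / \<kappa> s\<rfloor>)) * (H s z - Hopt s)))"


section \<open>The complexity bound\<close>

definition const0 ::
  "real \<Rightarrow> real \<Rightarrow> real \<Rightarrow> real \<Rightarrow> rvec \<Rightarrow> rvec \<times> rvec \<Rightarrow> rvec \<Rightarrow> rvec \<times> rvec \<Rightarrow> real"
  where "const0 \<beta>0 \<rho> \<epsilon>0 \<eta> xi li xs ls =
    2 * (norm ((xi, li) - (xs, ls)) + 2 * sqrt (\<epsilon>0 / \<beta>0) / (1 - sqrt (\<eta> / \<rho>)))\<^sup>2
    + 2 * (norm ls)\<^sup>2 + 2 * (norm xs)\<^sup>2"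

definition const1 ::
  "real \<Rightarrow> real \<Rightarrow> real \<Rightarrow> rvec \<times> rvec \<Rightarrow> real \<Rightarrow> real"
  where "const1 Lh1 \<beta>0 \<epsilon>0 ls c0 =
    Max {\<epsilon>0 + 2 * Lh1\<^sup>2 * \<beta>0 + c0 * \<beta>0, \<beta>0 * norm (snd ls) * sqrt c0, \<beta>0 * sqrt c0}"

definition const2 :: "real \<Rightarrow> real \<Rightarrow> real \<Rightarrow> real \<Rightarrow> real \<Rightarrow> real \<Rightarrow> real"
  where "const2 Lh1 \<beta>0 \<rho> \<epsilon>0 \<eta> c0 =
    log 2 (4 / \<eta>
      + 2 * \<beta>0 * ((11 + 2 * \<rho> powi (-2)) * (Lh1\<^sup>2 + 4 * c0) + 4 * inverse (2 * \<rho> - 1) * c0)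
          / (\<epsilon>0 * \<eta>)) + 1"

definition apg_rate :: "real \<Rightarrow> real \<Rightarrow> real \<Rightarrow> real \<Rightarrow> real \<Rightarrow> real"
  where "apg_rate Lf \<beta>0 nA \<mu>g \<epsilon> =
    (if \<mu>g > 0 then (sqrt (Lf * \<beta>0 + nA\<^sup>2) + sqrt \<mu>g) / sqrt (\<mu>g * \<epsilon>)
     else sqrt (Lf * \<beta>0 + nA\<^sup>2) / \<epsilon>)"

end

theory Submission
  imports Defs
begin

text \<open>
  Every outer step of the method approximately minimises
  \<open>H\<^sub>s x = f x + g x + h\<^sub>\<beta> (A x) + \<beta>/2 \<parallel>x - y\<parallel>\<^sup>2\<close>, where \<open>h\<^sub>\<beta>\<close> is the smoothing of \<open>h\<close> around the
  current multiplier and \<open>y\<close> is the last iterate. The pair of the new iterate and the new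
  multiplier is then an inexact step of the proximal point method for the saddle function \<open>L\<close>,
  and three facts give the bound. The core of the first two is proved for an abstract smoothed saddle
  function. All of them hold for every sample point separately, so the randomness only enters through
  the monotonicity of the expectation.

  \<^item> Inexact proximal steps are almost contractions towards every saddle point: an \<open>\<epsilon>\<close>-minimiser of
    \<open>H\<^sub>s\<close> increases the distance to it by at most \<open>sqrt (2 \<epsilon> / \<beta>)\<close> (\<open>near_min_contraction\<close>). As
    \<open>\<epsilon>\<^sub>s / \<beta>\<^sub>s\<close> decays geometrically because of \<open>\<eta> < \<rho>\<close>, all iterates and multipliers are bounded
    in terms of \<open>c\<^sub>0\<close> (\<open>iterate_bounds\<close>).

  \<^item> The old solution is a good starting point for the next subproblem: its excess there is at most
    \<open>2 (2 \<epsilon>\<^sub>s + M\<^sub>s)\<close> (\<open>warm_start\<close>, \<open>warm_start_M\<close>). The number of inner iterations is chosen so that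
    the restarts reduce exactly this quantity below \<open>\<epsilon>\<^sub>s\<^sub>+\<^sub>1\<close>, which keeps all subproblems solved to
    the prescribed accuracy (\<open>near_min_all\<close>). Since \<open>M\<^sub>s\<close> is at most a constant times \<open>\<beta>\<^sub>s\<close>, this
    takes \<open>O (s)\<close> restart periods (\<open>iteration_count\<close>).

  \<^item> The objective gap and the infeasibility of an \<open>\<epsilon>\<^sub>s\<close>-minimiser are \<open>O (\<epsilon>\<^sub>s + \<beta>\<^sub>s)\<close>
    (\<open>near_min_accuracy\<close>), hence \<open>O (\<rho>\<^sup>s)\<close>.

  So about \<open>ln (1/\<epsilon>)\<close> outer iterations suffice, and at the last one \<open>1/\<beta>\<^sub>s\<close> is of order \<open>1/\<epsilon>\<close>. A
  restart period is at most of order \<open>sqrt ((L\<^sub>f \<beta>\<^sub>s + \<parallel>A\<parallel>\<^sup>2) / (\<beta>\<^sub>s (\<mu>\<^sub>g + \<beta>\<^sub>s)))\<close>, which is at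
  most a constant times the claimed rate (\<open>restart_period_le_rate\<close>). The sum over the outer iterations
  and the number of periods in each of them cost one logarithmic factor each.

  No exact minimiser of a subproblem is ever needed: an inequality at an exact minimiser is replaced
  either by its version at \<open>\<delta>\<close>-minimisers, where \<open>\<delta>\<close> tends to zero, or by a comparison with a midpoint.
\<close>

section \<open>Finite-dimensional Euclidean spaces\<close>

lemma coord_simps [simp]:
  "coord (x + y) i = coord x i + coord y i"
  "coord (x - y) i = coord x i - coord y i"
  "coord (- x) i = - coord x i"
  "coord (c *\<^sub>R x) i = c * coord x i"
  "coord 0 i = 0"
  by (transfer; simp)+

lemma subspace_euclid: "subspace (euclid n)"
  by (auto simp: subspace_def euclid_def)

lemma linear_mat_vec: "linear (mat_vec m n B)"
  by (rule linearI; rule rvec_eqI)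
     (simp_all add: mat_vec.rep_eq algebra_simps sum.distrib sum_distrib_left)

lemma mat_vec_in_euclid: "mat_vec m n B x \<in> euclid m"
  by (simp add: euclid_def mat_vec.rep_eq)

lemma norm_sq_euclid:
  assumes "x \<in> euclid n"
  shows "(norm x)\<^sup>2 = (\<Sum>i<n. (coord x i)\<^sup>2)"
proof -
  have "{i. coord x i \<noteq> 0} \<subseteq> {..<n}"
    using assms by (auto simp: euclid_def not_less[symmetric])
  then show ?thesis
    unfolding power2_norm_eq_inner using inner_rvec_superset[of "{..<n}" x x]
    by (simp add: power2_eq_square)
qed

lemma abs_coord_le_norm:
  shows "\<bar>coord x i\<bar> \<le> norm x"
proof -
  obtain n where n: "\<forall>j\<in>{j. coord x j \<noteq> 0}. j < n" "i < n"
  proof -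
    obtain N where "\<forall>j\<in>{j. coord x j \<noteq> 0}. j \<le> N"
      using finite_coord[of x] finite_nat_set_iff_bounded_le by blast
    then show ?thesis by (intro that[of "Suc (max N i)"]) (auto simp: less_Suc_eq_le le_max_iff_disj)
  qed
  have "x \<in> euclid n" using n(1) by (auto simp: euclid_def)
  then have "(coord x i)\<^sup>2 \<le> (norm x)\<^sup>2"
    using n(2) member_le_sum[of i "{..<n}" "\<lambda>i. (coord x i)\<^sup>2"] by (simp add: norm_sq_euclid)
  then show ?thesis by (simp add: abs_le_square_iff[symmetric])
qed

text \<open>
  The coordinates of a Cauchy sequence converge, and on \<open>euclid n\<close> the norm is a finite sum of
  squares of coordinates. Completeness is what the existence of proximal points rests on.
\<close>

lemma complete_euclid: "Topological_Spaces.complete (euclid n)"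
  unfolding complete_def
proof (intro allI impI)
  fix X :: "nat \<Rightarrow> rvec"
  assume "(\<forall>k. X k \<in> euclid n) \<and> Cauchy X"
  then have X: "X k \<in> euclid n" and Cau: "Cauchy X" for k by auto
  have "Cauchy (\<lambda>k. coord (X k) i)" for i
    unfolding Cauchy_def
  proof (intro allI impI)
    fix e :: real assume "0 < e"
    then obtain M where M: "\<forall>j\<ge>M. \<forall>k\<ge>M. dist (X j) (X k) < e"
      using Cau unfolding Cauchy_def by blast
    show "\<exists>M. \<forall>j\<ge>M. \<forall>k\<ge>M. dist (coord (X j) i) (coord (X k) i) < e"
    proof (intro exI allI impI)
      fix j k assume "M \<le> j" "M \<le> k"
      then have "dist (X j) (X k) < e" using M by blast
      then show "dist (coord (X j) i) (coord (X k) i) < e"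
        using abs_coord_le_norm[of "X j - X k" i] by (simp add: dist_norm)
    qed
  qed
  then have lim: "(\<lambda>k. coord (X k) i) \<longlonglongrightarrow> lim (\<lambda>k. coord (X k) i)" for i
    by (simp add: Cauchy_convergent convergent_LIMSEQ_iff[symmetric])
  define x where "x = Abs_rvec (\<lambda>i. if i < n then lim (\<lambda>k. coord (X k) i) else 0)"
  have cx: "coord x i = (if i < n then lim (\<lambda>k. coord (X k) i) else 0)" for i
    unfolding x_def by (subst Abs_rvec_inverse) (auto intro: finite_subset[of _ "{..<n}"])
  have x: "x \<in> euclid n" by (simp add: euclid_def cx)
  have "(\<lambda>k. \<Sum>i<n. (coord (X k) i - coord x i)\<^sup>2) \<longlonglongrightarrow> (\<Sum>i<n. (coord x i - coord x i)\<^sup>2)"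
    by (intro tendsto_intros) (use lim cx in auto)
  moreover have "(norm (X k - x))\<^sup>2 = (\<Sum>i<n. (coord (X k) i - coord x i)\<^sup>2)" for k
    using norm_sq_euclid[OF subspace_diff[OF subspace_euclid X x]] by simp
  ultimately have "(\<lambda>k. (norm (X k - x))\<^sup>2) \<longlonglongrightarrow> 0" by simp
  then have "(\<lambda>k. norm (X k - x)) \<longlonglongrightarrow> 0"
    using tendsto_real_sqrt[of "\<lambda>k. (norm (X k - x))\<^sup>2" 0] by simp
  then have "X \<longlonglongrightarrow> x" using LIM_zero_cancel tendsto_norm_zero_iff by blast
  with x show "\<exists>l\<in>euclid n. X \<longlonglongrightarrow> l" by blast
qed

section \<open>Existence of proximal points\<close>

lemma norm_sq_convex_comb:
  fixes p q v :: "'c::real_inner"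
  shows "(norm ((1 - t) *\<^sub>R p + t *\<^sub>R q - v))\<^sup>2
    = (1 - t) * (norm (p - v))\<^sup>2 + t * (norm (q - v))\<^sup>2 - t * (1 - t) * (norm (p - q))\<^sup>2"
  unfolding power2_norm_eq_inner
  by (simp add: inner_diff_left inner_diff_right inner_add_left inner_add_right
      inner_commute algebra_simps)

text \<open>
  A minimising sequence of the strongly convex function \<open>h z + \<parallel>z - w\<parallel>\<^sup>2 / (2 \<beta>)\<close> is a Cauchy sequence,
  and its limit \<open>z\<close> is a minimiser by continuity. Comparing \<open>z\<close> with points on the segment towards
  \<open>z'\<close> shows that \<open>(w - z) / \<beta>\<close> is a subgradient of \<open>h\<close> at \<open>z\<close>.
\<close>

lemma prox_point_exists:
  fixes h :: "'b::real_inner \<Rightarrow> real"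
  assumes S: "Topological_Spaces.complete S" "S \<noteq> {}" and h: "convex_on S h" "continuous_on S h"
    and low: "\<And>z. z \<in> S \<Longrightarrow> c - L * norm z \<le> h z" and L: "0 \<le> L" and \<beta>: "0 < \<beta>"
  shows "\<exists>z\<in>S. \<forall>z'\<in>S. h z + inner ((1 / \<beta>) *\<^sub>R (w - z)) (z' - z) \<le> h z'"
proof -
  define J where "J z = h z + (norm (z - w))\<^sup>2 / (2 * \<beta>)" for z
  have conv: "convex S" using h(1) by (rule convex_on_imp_convex)
  have J_comb: "J ((1 - t) *\<^sub>R p + t *\<^sub>R q)
      \<le> (1 - t) * J p + t * J q - t * (1 - t) * (norm (p - q))\<^sup>2 / (2 * \<beta>)"
    if "p \<in> S" "q \<in> S" "0 \<le> t" "t \<le> 1" for p q t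
  proof -
    have "h ((1 - t) *\<^sub>R p + t *\<^sub>R q) \<le> (1 - t) * h p + t * h q"
      using h(1) that by (simp add: convex_on_def)
    then show ?thesis
      unfolding J_def norm_sq_convex_comb
      by (simp add: add_divide_distrib diff_divide_distrib distrib_left)
  qed
  have J_low: "c - L * norm w - \<beta> * L\<^sup>2 / 2 \<le> J z" if "z \<in> S" for z
  proof -
    have "L * norm z \<le> L * (norm (z - w) + norm w)"
      by (intro mult_left_mono L) (metis diff_add_cancel norm_triangle_ineq)
    moreover have "L * norm (z - w) \<le> (norm (z - w))\<^sup>2 / (2 * \<beta>) + \<beta> * L\<^sup>2 / 2"
    proof -
      have "0 \<le> (norm (z - w) - \<beta> * L)\<^sup>2 / (2 * \<beta>)" using \<beta> by simp
      then show ?thesis using \<beta> by (simp add: power2_eq_square field_simps)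
    qed
    ultimately show ?thesis using low[OF that] unfolding J_def by (simp add: ring_distribs)
  qed
  define I where "I = Inf (J ` S)"
  have I_le: "I \<le> J z" if "z \<in> S" for z
    unfolding I_def by (rule cInf_lower) (use that J_low in \<open>auto intro!: bdd_belowI2\<close>)
  have ex: "\<exists>z\<in>S. J z < I + r" if "0 < r" for r
  proof -
    have "\<exists>y\<in>J ` S. y < I + r"
      by (rule cInf_lessD) (use S(2) that in \<open>auto simp: I_def\<close>)
    then show ?thesis by blast
  qed
  then have "\<forall>k. \<exists>z\<in>S. J z < I + 1 / real (Suc k)" by simp
  then obtain z where z: "\<And>k. z k \<in> S" "\<And>k. J (z k) < I + 1 / real (Suc k)" by metis
  \<comment> \<open>Strong convexity at the midpoint of two near-minimisers.\<close>
  have close: "(norm (p - q))\<^sup>2 \<le> 8 * \<beta> * r"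
    if "p \<in> S" "q \<in> S" "J p \<le> I + r" "J q \<le> I + r" for p q r
  proof -
    have m: "(1 - 1 / 2) *\<^sub>R p + (1 / 2) *\<^sub>R q \<in> S"
      using that conv by (simp add: convex_def)
    have "I \<le> (1 - 1 / 2) * J p + (1 / 2) * J q - (1 / 2) * (1 - 1 / 2) * (norm (p - q))\<^sup>2 / (2 * \<beta>)"
      using I_le[OF m] J_comb[OF that(1,2), of "1 / 2"] by linarith
    then have "(norm (p - q))\<^sup>2 / (8 * \<beta>) \<le> r" using that(3,4) by (simp add: field_simps)
    then show ?thesis using \<beta> by (simp add: field_simps)
  qed
  have "Cauchy z"
    unfolding Cauchy_def
  proof (intro allI impI)
    fix e :: real assume e: "0 < e"
    obtain M where M: "inverse (real (Suc M)) < e\<^sup>2 / (8 * \<beta>)"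
      using reals_Archimedean[of "e\<^sup>2 / (8 * \<beta>)"] e \<beta> by auto
    have Jz: "J (z k) \<le> I + 1 / real (Suc M)" if "M \<le> k" for k
    proof -
      have "1 / real (Suc k) \<le> 1 / real (Suc M)" using that by (intro divide_left_mono) auto
      then show ?thesis using z(2)[of k] by simp
    qed
    show "\<exists>M. \<forall>j\<ge>M. \<forall>k\<ge>M. dist (z j) (z k) < e"
    proof (intro exI allI impI)
      fix j k assume "M \<le> j" "M \<le> k"
      then have "(norm (z j - z k))\<^sup>2 \<le> 8 * \<beta> * (1 / real (Suc M))"
        by (intro close z Jz)
      also have "\<dots> < e\<^sup>2" using M \<beta> by (simp add: field_simps)
      finally show "dist (z j) (z k) < e" using e by (simp add: dist_norm power_less_imp_less_base)
    qed
  qed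
  then obtain z0 where z0: "z0 \<in> S" "z \<longlonglongrightarrow> z0"
    using S(1) z(1) unfolding complete_def by blast
  have "continuous_on S J"
    unfolding J_def using \<beta> by (intro continuous_intros h(2)) auto
  then have "(\<lambda>k. J (z k)) \<longlonglongrightarrow> J z0"
    using z0 z(1) unfolding continuous_on_sequentially by (auto simp: o_def)
  moreover have "(\<lambda>k. I + 1 / real (Suc k)) \<longlonglongrightarrow> I"
    using LIMSEQ_inverse_real_of_nat_add[of I] by (simp add: inverse_eq_divide)
  ultimately have "J z0 \<le> I"
    by (rule LIMSEQ_le) (use z(2) less_imp_le in blast)
  then have J_min: "J z0 \<le> J p" if "p \<in> S" for p using I_le[OF that] by simp
  show ?thesis
  proof (intro bexI ballI)
    fix z' assume z': "z' \<in> S"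
    define D where "D = h z' - h z0 - inner ((1 / \<beta>) *\<^sub>R (w - z0)) (z' - z0)"
    \<comment> \<open>Minimality along the segment, divided by its parameter \<open>t\<close>; then \<open>t\<close> tends to zero.\<close>
    have "0 \<le> D + t * (norm (z' - z0))\<^sup>2 / (2 * \<beta>)" if t: "0 < t" "t < 1" for t
    proof -
      have m: "(1 - t) *\<^sub>R z0 + t *\<^sub>R z' \<in> S" using t z' z0 conv by (simp add: convex_def)
      have "J z0 \<le> (1 - t) * J z0 + t * J z' - t * (1 - t) * (norm (z0 - z'))\<^sup>2 / (2 * \<beta>)"
        using J_min[OF m] J_comb[OF z0(1) z', of t] t by linarith
      then have "t * 0 \<le> t * (J z' - J z0 - (1 - t) * (norm (z0 - z'))\<^sup>2 / (2 * \<beta>))"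
        by (simp add: algebra_simps)
      then have "0 \<le> J z' - J z0 - (1 - t) * (norm (z0 - z'))\<^sup>2 / (2 * \<beta>)"
        using t(1) by (simp only: mult_le_cancel_left_pos)
      also have "\<dots> = D + t * (norm (z' - z0))\<^sup>2 / (2 * \<beta>)"
        unfolding J_def D_def power2_norm_eq_inner using \<beta>
        by (simp add: inner_diff_left inner_diff_right inner_commute field_simps)
      finally show ?thesis .
    qed
    then have "\<forall>\<^sub>F t in at_right 0. 0 \<le> D + t * (norm (z' - z0))\<^sup>2 / (2 * \<beta>)"
      by (auto simp: eventually_at_right[of 0 1] intro!: exI[of _ 1])
    moreover have "((\<lambda>t. D + t * (norm (z' - z0))\<^sup>2 / (2 * \<beta>)) \<longlongrightarrow> D + 0 * (norm (z' - z0))\<^sup>2 / (2 * \<beta>)) (at_right 0)"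
      by (intro tendsto_intros) (use \<beta> in auto)
    ultimately have "0 \<le> D"
      by (auto dest!: tendsto_lowerbound)
    then show "h z0 + inner ((1 / \<beta>) *\<^sub>R (w - z0)) (z' - z0) \<le> h z'" by (simp add: D_def)
  qed (rule z0(1))
qed

section \<open>Smoothed saddle functions\<close>

lemma norm_Pair_sq: "(norm (a, b))\<^sup>2 = (norm a)\<^sup>2 + (norm b)\<^sup>2"
  by (simp add: norm_Pair)

text \<open>
  The setting is the saddle function \<open>\<phi> x + \<langle>v, A x\<rangle> - hc v\<close> on \<open>C \<times> W\<close>, where \<open>prox u l \<beta>\<close> maximises the
  dual part \<open>\<langle>v, u\<rangle> - hc v - \<beta>/2 \<parallel>v - l\<parallel>\<^sup>2\<close>. Convexity of \<open>hc\<close> and existence of the maximiser enter only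
  through \<open>prox_max\<close>: the maximum is attained with the quadratic growth of a \<open>\<beta>\<close>-strongly concave
  function.
\<close>

locale smoothed_saddle =
  fixes C :: "'a::real_inner set" and \<phi> :: "'a \<Rightarrow> real" and A :: "'a \<Rightarrow> 'b::real_inner"
    and W :: "'b set" and hc :: "'b \<Rightarrow> real" and prox :: "'b \<Rightarrow> 'b \<Rightarrow> real \<Rightarrow> 'b"
  assumes convex_\<phi>: "convex_on C \<phi>"
    and linear_A: "linear A"
    and prox_in: "\<lbrakk>x \<in> C; l \<in> W; 0 < \<beta>\<rbrakk> \<Longrightarrow> prox (A x) l \<beta> \<in> W"
    and prox_max: "\<lbrakk>x \<in> C; l \<in> W; 0 < \<beta>; v \<in> W\<rbrakk> \<Longrightarrow>
      inner v (A x) - hc v - \<beta> / 2 * (norm (v - l))\<^sup>2 + \<beta> / 2 * (norm (v - prox (A x) l \<beta>))\<^sup>2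
      \<le> inner (prox (A x) l \<beta>) (A x) - hc (prox (A x) l \<beta>)
          - \<beta> / 2 * (norm (prox (A x) l \<beta> - l))\<^sup>2"
begin

definition smooth :: "'b \<Rightarrow> real \<Rightarrow> 'a \<Rightarrow> real"
  where "smooth l \<beta> x = inner (prox (A x) l \<beta>) (A x) - hc (prox (A x) l \<beta>)
    - \<beta> / 2 * (norm (prox (A x) l \<beta> - l))\<^sup>2"

definition sub_obj :: "'a \<Rightarrow> 'b \<Rightarrow> real \<Rightarrow> 'a \<Rightarrow> real"
  where "sub_obj y l \<beta> x = \<phi> x + smooth l \<beta> x + \<beta> / 2 * (norm (x - y))\<^sup>2"

text \<open>
  The result of a proximal step: the new primal point together with the multiplier it induces.
\<close>

definition step :: "'b \<Rightarrow> real \<Rightarrow> 'a \<Rightarrow> 'a \<times> 'b"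
  where "step l \<beta> x = (x, prox (A x) l \<beta>)"

definition near_min :: "'a \<Rightarrow> 'b \<Rightarrow> real \<Rightarrow> real \<Rightarrow> 'a \<Rightarrow> bool"
  where "near_min y l \<beta> e w \<longleftrightarrow> w \<in> C \<and> (\<forall>a\<in>C. sub_obj y l \<beta> w \<le> sub_obj y l \<beta> a + e)"

lemma convex_C: "convex C"
  using convex_\<phi> by (rule convex_on_imp_convex)

lemma comb_in_C:
  assumes "a \<in> C" "b \<in> C" "0 \<le> t" "t \<le> 1"
  shows "(1 - t) *\<^sub>R a + t *\<^sub>R b \<in> C"
  using convex_C assms by (simp add: convex_def)

lemma A_comb: "A ((1 - t) *\<^sub>R a + t *\<^sub>R b) = (1 - t) *\<^sub>R A a + t *\<^sub>R A b"
  by (simp add: linear_A linear_add linear_scale)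

lemma smooth_ge:
  assumes "x \<in> C" "l \<in> W" "0 < \<beta>" "v \<in> W"
  shows "inner v (A x) - hc v - \<beta> / 2 * (norm (v - l))\<^sup>2 + \<beta> / 2 * (norm (v - prox (A x) l \<beta>))\<^sup>2
      \<le> smooth l \<beta> x"
  unfolding smooth_def by (rule prox_max[OF assms])

text \<open>
  The smoothed function is a convex function of \<open>A x\<close> with the \<open>1/\<beta>\<close>-Lipschitz gradient
  \<open>prox (A x) l \<beta>\<close>, which improves convexity by the squared distance of the gradients. The proof tests
  the two maxima at the end points with the maximiser at the intermediate point.
\<close>

lemma smooth_comb:
  assumes ab: "a \<in> C" "b \<in> C" and l: "l \<in> W" "0 < \<beta>" and t: "0 \<le> t" "t \<le> 1"
  shows "smooth l \<beta> ((1 - t) *\<^sub>R a + t *\<^sub>R b)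
    \<le> (1 - t) * smooth l \<beta> a + t * smooth l \<beta> b
      - t * (1 - t) * (\<beta> / 2 * (norm (prox (A a) l \<beta> - prox (A b) l \<beta>))\<^sup>2)"
proof -
  define m where "m = (1 - t) *\<^sub>R a + t *\<^sub>R b"
  have mC: "m \<in> C" unfolding m_def by (rule comb_in_C[OF ab t])
  let ?v = "prox (A m) l \<beta>" and ?p = "prox (A a) l \<beta>" and ?q = "prox (A b) l \<beta>"
  have v: "?v \<in> W" using mC l by (rule prox_in)
  have "(1 - t) * (inner ?v (A a) - hc ?v - \<beta> / 2 * (norm (?v - l))\<^sup>2 + \<beta> / 2 * (norm (?v - ?p))\<^sup>2)
      \<le> (1 - t) * smooth l \<beta> a"
    using t by (intro mult_left_mono smooth_ge ab l v) auto
  moreover have "t * (inner ?v (A b) - hc ?v - \<beta> / 2 * (norm (?v - l))\<^sup>2 + \<beta> / 2 * (norm (?v - ?q))\<^sup>2)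
      \<le> t * smooth l \<beta> b"
    using t by (intro mult_left_mono smooth_ge ab l v) auto
  moreover have "inner ?v (A m) = (1 - t) * inner ?v (A a) + t * inner ?v (A b)"
    by (simp add: A_comb[of t a b, folded m_def] inner_add_right)
  moreover have "0 \<le> \<beta> / 2 * ((1 - t) * (norm (?v - ?p))\<^sup>2 + t * (norm (?v - ?q))\<^sup>2
      - t * (1 - t) * (norm (?p - ?q))\<^sup>2)"
    unfolding norm_minus_commute[of ?v] norm_sq_convex_comb[of t ?p ?q ?v, symmetric]
    using l(2) by simp
  ultimately show ?thesis
    unfolding m_def[symmetric] smooth_def[of l \<beta> m]
    by (simp add: algebra_simps add_divide_distrib diff_divide_distrib)
qed

text \<open>
  The subproblem is strongly convex even when the distance is measured in the primal and the dual
  variable together. This is why its value controls the error of the multiplier as well.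
\<close>

lemma sub_obj_comb:
  assumes ab: "a \<in> C" "b \<in> C" and l: "l \<in> W" "0 < \<beta>" and t: "0 \<le> t" "t \<le> 1"
  shows "sub_obj y l \<beta> ((1 - t) *\<^sub>R a + t *\<^sub>R b)
    \<le> (1 - t) * sub_obj y l \<beta> a + t * sub_obj y l \<beta> b
      - t * (1 - t) * (\<beta> / 2 * (norm (step l \<beta> a - step l \<beta> b))\<^sup>2)"
proof -
  define m where "m = (1 - t) *\<^sub>R a + t *\<^sub>R b"
  have "\<phi> m \<le> (1 - t) * \<phi> a + t * \<phi> b"
    unfolding m_def using convex_\<phi> ab t by (simp add: convex_on_def)
  moreover have "\<beta> / 2 * (norm (m - y))\<^sup>2
      = \<beta> / 2 * ((1 - t) * (norm (a - y))\<^sup>2 + t * (norm (b - y))\<^sup>2 - t * (1 - t) * (norm (a - b))\<^sup>2)"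
    unfolding m_def by (simp only: norm_sq_convex_comb)
  ultimately show ?thesis
    using smooth_comb[OF assms]
    unfolding sub_obj_def step_def m_def[symmetric]
    by (simp add: norm_Pair_sq algebra_simps add_divide_distrib diff_divide_distrib)
qed

text \<open>
  The midpoint of \<open>a\<close> and \<open>w\<close> cannot be better than \<open>w\<close> by more than \<open>e\<close>. Halving costs a factor two
  in the growth constant and in the error, in exchange for not needing a minimiser.
\<close>

lemma near_min_growth:
  assumes w: "near_min y l \<beta> e w" and a: "a \<in> C" and l: "l \<in> W" "0 < \<beta>"
  shows "sub_obj y l \<beta> w + \<beta> / 4 * (norm (step l \<beta> a - step l \<beta> w))\<^sup>2 \<le> sub_obj y l \<beta> a + 2 * e"
proof -
  have wC: "w \<in> C" using w by (simp add: near_min_def)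
  let ?m = "(1 - 1 / 2) *\<^sub>R a + (1 / 2) *\<^sub>R w"
  have "?m \<in> C" by (rule comb_in_C[OF a wC]) auto
  then have "sub_obj y l \<beta> w \<le> sub_obj y l \<beta> ?m + e" using w by (simp add: near_min_def)
  with sub_obj_comb[OF a wC l, of "1 / 2" y] show ?thesis by simp
qed

text \<open>
  An \<open>e\<close>-minimiser bounds the objective from below, so points arbitrarily close to the infimum exist.
\<close>

lemma near_min_exists:
  assumes w: "near_min y l \<beta> e w" and \<delta>: "0 < \<delta>"
  shows "\<exists>a. near_min y l \<beta> \<delta> a \<and> sub_obj y l \<beta> w \<le> sub_obj y l \<beta> a + e"
proof -
  define I where "I = Inf (sub_obj y l \<beta> ` C)"
  have bdd: "bdd_below (sub_obj y l \<beta> ` C)"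
    by (rule bdd_belowI2[of _ "sub_obj y l \<beta> w - e"]) (use w in \<open>auto simp: near_min_def\<close>)
  have "\<exists>r\<in>sub_obj y l \<beta> ` C. r < I + \<delta>"
    by (rule cInf_lessD) (use w \<delta> in \<open>auto simp: I_def near_min_def\<close>)
  then obtain a where a: "a \<in> C" "sub_obj y l \<beta> a < I + \<delta>" by blast
  have "I \<le> sub_obj y l \<beta> b" if "b \<in> C" for b
    unfolding I_def using that bdd by (intro cInf_lower) auto
  with a have "near_min y l \<beta> \<delta> a" unfolding near_min_def by (smt (verit))
  moreover have "sub_obj y l \<beta> w \<le> sub_obj y l \<beta> a + e"
    using w a by (simp add: near_min_def)
  ultimately show ?thesis by blast
qed

end

section \<open>Inexact proximal steps towards a saddle point\<close>

locale smoothed_saddle_point = smoothed_saddle C \<phi> A W hc prox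
  for C :: "'a::real_inner set" and \<phi> :: "'a \<Rightarrow> real" and A :: "'a \<Rightarrow> 'b::real_inner"
    and W :: "'b set" and hc :: "'b \<Rightarrow> real" and prox :: "'b \<Rightarrow> 'b \<Rightarrow> real \<Rightarrow> 'b" +
  fixes xs :: 'a and ls :: 'b and F :: real
  assumes xs: "xs \<in> C" and ls: "ls \<in> W"
    and saddle_x: "a \<in> C \<Longrightarrow> F \<le> \<phi> a + inner ls (A a) - hc ls"
    and saddle_l: "v \<in> W \<Longrightarrow> \<phi> xs + inner v (A xs) - hc v \<le> F"
begin

text \<open>
  This is the classical inequality \<open>\<parallel>z\<^sup>+ - z\<^sup>*\<parallel> \<le> \<parallel>z - z\<^sup>*\<parallel>\<close> for a proximal step, with an error term. The
  optimality condition of the step is replaced by the comparison of \<open>a\<close> with the point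
  \<open>(1 - t) a + t xs\<close>: the loss \<open>\<delta>\<close> gets divided by \<open>t\<close>, so \<open>t\<close> has to tend to zero more slowly
  than \<open>\<delta>\<close>.
\<close>

lemma near_min_fejer:
  assumes a: "near_min y l \<beta> \<delta> a" and l: "l \<in> W" "0 < \<beta>" and t: "0 < t" "t < 1"
  shows "(1 - t) * (norm (step l \<beta> a - (xs, ls)))\<^sup>2
    \<le> (norm ((y, l) - (xs, ls)))\<^sup>2 + 2 * \<delta> / (\<beta> * t)"
proof -
  have aC: "a \<in> C" using a by (simp add: near_min_def)
  define b where "b = (1 - t) *\<^sub>R a + t *\<^sub>R xs"
  have bC: "b \<in> C" unfolding b_def by (rule comb_in_C[OF aC xs]) (use t in auto)
  let ?\<mu> = "prox (A b) l \<beta>" and ?p = "prox (A a) l \<beta>"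
  have \<mu>: "?\<mu> \<in> W" by (rule prox_in[OF bC l])
  let ?N = "\<lambda>v. (norm v)\<^sup>2"
  have min: "sub_obj y l \<beta> a \<le> sub_obj y l \<beta> b + \<delta>"
    using a bC by (simp add: near_min_def)
  have conv: "\<phi> b \<le> (1 - t) * \<phi> a + t * \<phi> xs"
    unfolding b_def using convex_\<phi> aC xs t by (simp add: convex_on_def)
  have lin: "inner ?\<mu> (A b) = (1 - t) * inner ?\<mu> (A a) + t * inner ?\<mu> (A xs)"
    by (simp add: A_comb[of t a xs, folded b_def] inner_add_right)
  have dist: "?N (b - y) = (1 - t) * ?N (a - y) + t * ?N (xs - y) - t * (1 - t) * ?N (a - xs)"
    unfolding b_def by (rule norm_sq_convex_comb)
  \<comment> \<open>The multiplier at \<open>b\<close> is a test point for the maximum at \<open>a\<close>.\<close>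
  have up: "(1 - t) * (inner ?\<mu> (A a) - hc ?\<mu> - \<beta> / 2 * ?N (?\<mu> - l)) \<le> (1 - t) * smooth l \<beta> a"
    using smooth_ge[OF aC l \<mu>] l(2) t
    by (intro mult_left_mono) (auto intro: order_trans[rotated])
  have sl: "t * (\<phi> xs + inner ?\<mu> (A xs) - hc ?\<mu>) \<le> t * F"
    using saddle_l[OF \<mu>] t by simp
  \<comment> \<open>The dual solution is a test point for the maximum at \<open>a\<close>; its growth term is the
    dual half of the distance.\<close>
  have low: "F + \<beta> / 2 * (?N (a - y) - ?N (ls - l) + ?N (ls - ?p)) \<le> sub_obj y l \<beta> a"
    using smooth_ge[OF aC l ls] saddle_x[OF aC] unfolding sub_obj_def by (simp add: algebra_simps)
  have H_b: "sub_obj y l \<beta> b \<le> (1 - t) * sub_obj y l \<beta> a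
     + t * (F + \<beta> / 2 * (?N (xs - y) - ?N (?\<mu> - l))) - t * (1 - t) * (\<beta> / 2 * ?N (a - xs))"
    using conv up sl unfolding sub_obj_def[of y l \<beta> b] sub_obj_def[of y l \<beta> a]
      smooth_def[of l \<beta> b] lin dist
    by (simp add: algebra_simps add_divide_distrib diff_divide_distrib)
  have "t * sub_obj y l \<beta> a \<le> \<delta>
     + t * (F + \<beta> / 2 * (?N (xs - y) - ?N (?\<mu> - l))) - t * (1 - t) * (\<beta> / 2 * ?N (a - xs))"
    using min H_b by (simp add: algebra_simps)
  moreover have "t * (F + \<beta> / 2 * (?N (a - y) - ?N (ls - l) + ?N (ls - ?p))) \<le> t * sub_obj y l \<beta> a"
    using low t by (intro mult_left_mono) auto
  ultimately have "(\<beta> * t / 2) * (?N (a - y) + ?N (?\<mu> - l) + ?N (ls - ?p) + (1 - t) * ?N (a - xs))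
     \<le> \<delta> + (\<beta> * t / 2) * (?N (xs - y) + ?N (ls - l))"
    by (simp add: algebra_simps add_divide_distrib diff_divide_distrib)
  also have "\<dots> = (\<beta> * t / 2) * (?N (xs - y) + ?N (ls - l) + 2 * \<delta> / (\<beta> * t))"
    using l t by (simp add: field_simps)
  finally have "?N (a - y) + ?N (?\<mu> - l) + ?N (ls - ?p) + (1 - t) * ?N (a - xs)
     \<le> ?N (xs - y) + ?N (ls - l) + 2 * \<delta> / (\<beta> * t)"
    using l t by (subst (asm) mult_le_cancel_left_pos) auto
  moreover have "(1 - t) * ?N (?p - ls) \<le> ?N (?p - ls)"
    using t by (intro mult_left_le_one_le) auto
  moreover have "0 \<le> ?N (a - y)" "0 \<le> ?N (?\<mu> - l)" by auto
  moreover have "?N (xs - y) = ?N (y - xs)" "?N (ls - l) = ?N (l - ls)" "?N (ls - ?p) = ?N (?p - ls)"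
    by (simp_all add: norm_minus_commute)
  ultimately show ?thesis
    unfolding step_def diff_Pair norm_Pair_sq distrib_left by linarith
qed

text \<open>
  An \<open>r\<^sup>2\<close>-minimiser \<open>a\<close> is almost as close to the saddle point as the old point, by
  \<open>near_min_fejer\<close> with \<open>t = r\<close>, and \<open>w\<close> is within \<open>sqrt (2 e / \<beta>)\<close> of \<open>a\<close>, up to terms that vanish
  with \<open>r\<close>, by strong convexity. The limit \<open>r \<longlongrightarrow> 0\<close> gives the claim.
\<close>

theorem near_min_contraction:
  assumes w: "near_min y l \<beta> e w" and l: "l \<in> W" "0 < \<beta>"
  shows "norm (step l \<beta> w - (xs, ls)) \<le> norm ((y, l) - (xs, ls)) + sqrt (2 * e / \<beta>)"
proof -
  let ?D = "norm ((y, l) - (xs, ls))"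
  let ?bound = "\<lambda>r. sqrt ((?D\<^sup>2 + 2 * r / \<beta>) / (1 - r)) + sqrt (2 * (e + r) / (\<beta> * (1 - r)))"
  have wC: "w \<in> C" using w by (simp add: near_min_def)
  have bound: "norm (step l \<beta> w - (xs, ls)) \<le> ?bound r" if r: "0 < r" "r < 1" for r
  proof -
    obtain a where a: "near_min y l \<beta> (r\<^sup>2) a" "sub_obj y l \<beta> w \<le> sub_obj y l \<beta> a + e"
      using near_min_exists[OF w, of "r\<^sup>2"] r by auto
    have aC: "a \<in> C" using a by (simp add: near_min_def)
    have "(1 - r) * (norm (step l \<beta> a - (xs, ls)))\<^sup>2 \<le> ?D\<^sup>2 + 2 * r / \<beta>"
      using near_min_fejer[OF a(1) l r] r by (simp add: power2_eq_square)
    then have "(norm (step l \<beta> a - (xs, ls)))\<^sup>2 \<le> (?D\<^sup>2 + 2 * r / \<beta>) / (1 - r)"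
      using r by (simp add: field_simps)
    then have n1: "norm (step l \<beta> a - (xs, ls)) \<le> sqrt ((?D\<^sup>2 + 2 * r / \<beta>) / (1 - r))"
      by (rule real_le_rsqrt)
    \<comment> \<open>The weight \<open>r\<close> on the worse point \<open>w\<close> is what yields the sharp constant \<open>2\<close> under the
      root; the midpoint would give \<open>4\<close>.\<close>
    let ?m = "(1 - r) *\<^sub>R a + r *\<^sub>R w"
    have "?m \<in> C" by (rule comb_in_C[OF aC wC]) (use r in auto)
    then have "sub_obj y l \<beta> a \<le> sub_obj y l \<beta> ?m + r\<^sup>2" using a(1) by (simp add: near_min_def)
    also have "\<dots> \<le> (1 - r) * sub_obj y l \<beta> a + r * sub_obj y l \<beta> w
      - r * (1 - r) * (\<beta> / 2 * (norm (step l \<beta> a - step l \<beta> w))\<^sup>2) + r\<^sup>2"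
      using sub_obj_comb[OF aC wC l, of r y] r by simp
    also have "r * sub_obj y l \<beta> w \<le> r * (sub_obj y l \<beta> a + e)"
      using a(2) r by (intro mult_left_mono) auto
    finally have "r * ((1 - r) * (\<beta> / 2 * (norm (step l \<beta> a - step l \<beta> w))\<^sup>2)) \<le> r * (e + r)"
      by (simp add: algebra_simps power2_eq_square)
    then have "(1 - r) * (\<beta> / 2 * (norm (step l \<beta> a - step l \<beta> w))\<^sup>2) \<le> e + r"
      using r by (subst (asm) mult_le_cancel_left_pos) auto
    then have "(norm (step l \<beta> w - step l \<beta> a))\<^sup>2 \<le> 2 * (e + r) / (\<beta> * (1 - r))"
      using r l by (simp add: field_simps norm_minus_commute)
    then have n2: "norm (step l \<beta> w - step l \<beta> a) \<le> sqrt (2 * (e + r) / (\<beta> * (1 - r)))"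
      by (rule real_le_rsqrt)
    have "norm (step l \<beta> w - (xs, ls))
        \<le> norm (step l \<beta> w - step l \<beta> a) + norm (step l \<beta> a - (xs, ls))"
      using dist_triangle[of "step l \<beta> w" "(xs, ls)" "step l \<beta> a"] by (simp only: dist_norm)
    with n1 n2 show ?thesis by simp
  qed
  have "(?bound \<longlongrightarrow> sqrt ((?D\<^sup>2 + 2 * 0 / \<beta>) / (1 - 0)) + sqrt (2 * (e + 0) / (\<beta> * (1 - 0)))) (at_right 0)"
    by (intro tendsto_intros) (use l in auto)
  moreover have "\<forall>\<^sub>F r in at_right 0. norm (step l \<beta> w - (xs, ls)) \<le> ?bound r"
    by (rule eventually_mono[OF eventually_at_right_real[of 0 1]]) (simp, rule bound, simp_all)
  ultimately show ?thesis
    using tendsto_lowerbound[of ?bound _ "at_right 0" "norm (step l \<beta> w - (xs, ls))"] by simp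
qed

end

section \<open>Changing the smoothing parameters\<close>

context smoothed_saddle
begin

text \<open>
  The optimality conditions of the two maximisers give \<open>\<beta> (l - l')\<close> and \<open>\<beta>' (l' - v)\<close> as elements of
  one monotone operator, shifted by \<open>A x\<close>, at \<open>l'\<close> and \<open>v\<close>. Monotonicity is obtained here by adding
  the two growth inequalities, in which \<open>hc\<close> cancels.
\<close>

lemma prox_restart_shift:
  assumes x: "x \<in> C" and l: "l \<in> W" "0 < \<beta>" "0 < \<beta>'" and l': "l' = prox (A x) l \<beta>"
  shows "norm (prox (A x) l' \<beta>' - l') \<le> \<beta> / \<beta>' * norm (l' - l)"
proof -
  let ?v = "prox (A x) l' \<beta>'"
  have l'W: "l' \<in> W" using prox_in[OF x l(1,2)] l' by simp
  have v: "?v \<in> W" by (rule prox_in[OF x l'W l(3)])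
  have "\<beta>' * (norm (?v - l'))\<^sup>2
      \<le> \<beta> / 2 * ((norm (?v - l))\<^sup>2 - (norm (?v - l'))\<^sup>2 - (norm (l' - l))\<^sup>2)"
    using prox_max[OF x l(1,2) v] prox_max[OF x l'W l(3) l'W] unfolding l'[symmetric]
    by (simp add: norm_minus_commute algebra_simps)
  also have "\<dots> = \<beta> * inner (?v - l') (l' - l)"
    unfolding power2_norm_eq_inner
    by (simp add: inner_diff_left inner_diff_right inner_commute algebra_simps)
  also have "\<dots> \<le> \<beta> * (norm (?v - l') * norm (l' - l))"
    using l by (intro mult_left_mono norm_cauchy_schwarz) auto
  finally have *: "norm (?v - l') * (\<beta>' * norm (?v - l')) \<le> norm (?v - l') * (\<beta> * norm (l' - l))"
    by (simp add: power2_eq_square algebra_simps)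
  show ?thesis
  proof (cases "?v = l'")
    case False
    with * have "\<beta>' * norm (?v - l') \<le> \<beta> * norm (l' - l)"
      by (subst (asm) mult_le_cancel_left_pos) auto
    then show ?thesis using l by (simp add: field_simps)
  qed (use l in auto)
qed

text \<open>
  The point \<open>w\<close> nearly minimises the old subproblem, and the new one differs from it in three ways.
  The multiplier and \<open>\<beta>\<close> change the smoothed function at \<open>w\<close> and at \<open>a\<close>, and the proximal centre
  moves from \<open>y\<close> to \<open>w\<close>. What the changes at \<open>a\<close> lose relative to the distance between \<open>a\<close> and \<open>w\<close>,
  and between their multipliers, is paid by the growth of the old subproblem, provided that
  \<open>\<beta> < 2 \<beta>'\<close>.
\<close>

theorem warm_start:
  assumes w: "near_min y l \<beta> e w" and a: "a \<in> C" and l: "l \<in> W"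
    and \<beta>: "0 < \<beta>'" "\<beta>' \<le> \<beta>" "\<beta> < 2 * \<beta>'" and l': "l' = prox (A w) l \<beta>"
  shows "sub_obj w l' \<beta>' w \<le> sub_obj w l' \<beta>' a + 2 * e + 3 / 2 * \<beta> * (norm (l' - l))\<^sup>2
    + (\<beta> - \<beta>') / 2 * (norm (prox (A w) l' \<beta>' - l'))\<^sup>2
    + \<beta>\<^sup>2 / (2 * \<beta>' - \<beta>) * (norm (y - w))\<^sup>2"
proof -
  have \<beta>0: "0 < \<beta>" using \<beta> by simp
  have wC: "w \<in> C" using w by (simp add: near_min_def)
  have l'W: "l' \<in> W" using prox_in[OF wC l \<beta>0] l' by simp
  let ?N = "\<lambda>v. (norm v)\<^sup>2"
  let ?v = "prox (A w) l' \<beta>'" and ?q = "prox (A a) l \<beta>"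
  have v: "?v \<in> W" by (rule prox_in[OF wC l'W \<beta>(1)])
  have q: "?q \<in> W" by (rule prox_in[OF a l \<beta>0])
  have growth: "sub_obj y l \<beta> w + \<beta> / 4 * ?N (a - w) + \<beta> / 4 * ?N (?q - l') \<le> sub_obj y l \<beta> a + 2 * e"
    using near_min_growth[OF w a l \<beta>0] unfolding step_def l'[symmetric]
    by (simp add: norm_Pair_sq algebra_simps)
  have change_w: "smooth l' \<beta>' w \<le> smooth l \<beta> w + (\<beta> - \<beta>') / 2 * ?N (?v - l') + \<beta> * ?N (l' - l)"
  proof -
    have "smooth l' \<beta>' w - smooth l \<beta> w
        \<le> \<beta> / 2 * ?N (?v - l) - \<beta>' / 2 * ?N (?v - l') - \<beta> / 2 * ?N (?v - l')"
      using smooth_ge[OF wC l \<beta>0 v] unfolding l'[symmetric] smooth_def[of l' \<beta>'] by simp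
    moreover have "\<beta> / 2 * ?N (?v - l) \<le> \<beta> / 2 * (2 * ?N (?v - l') + 2 * ?N (l' - l))"
    proof (intro mult_left_mono)
      have "0 \<le> ?N ((?v - l') - (l' - l))" by simp
      then show "?N (?v - l) \<le> 2 * ?N (?v - l') + 2 * ?N (l' - l)"
        unfolding power2_norm_eq_inner
        by (simp add: inner_diff_left inner_diff_right inner_commute algebra_simps)
    qed (use \<beta>0 in auto)
    ultimately show ?thesis by (simp add: algebra_simps add_divide_distrib diff_divide_distrib)
  qed
  have change_a: "smooth l \<beta> a \<le> smooth l' \<beta>' a + \<beta> / 4 * ?N (?q - l') + \<beta> / 2 * ?N (l' - l)"
  proof -
    have "\<beta>' / 2 * ?N (?q - l') \<le> \<beta> / 2 * ?N (?q - l')"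
      using \<beta> by (intro mult_right_mono) auto
    moreover have "0 \<le> \<beta>' / 2 * ?N (?q - prox (A a) l' \<beta>')" using \<beta> by simp
    ultimately have "smooth l \<beta> a - smooth l' \<beta>' a \<le> \<beta> / 2 * ?N (?q - l') - \<beta> / 2 * ?N (?q - l)"
      using smooth_ge[OF a l'W \<beta>(1) q] unfolding smooth_def[of l \<beta>] by simp
    also have "\<dots> = \<beta> / 2 * (?N (?q - l') - ?N (?q - l))" by (simp add: algebra_simps)
    also have "\<dots> \<le> \<beta> / 2 * (1 / 2 * ?N (?q - l') + ?N (l' - l))"
    proof (intro mult_left_mono)
      \<comment> \<open>The weight \<open>2\<close> makes the remaining term \<open>\<beta>/4 \<parallel>q - l'\<parallel>\<^sup>2\<close> exactly the dual part of the growth.\<close>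
      have "0 \<le> ?N ((?q - l') + 2 *\<^sub>R (l' - l))" by simp
      then show "?N (?q - l') - ?N (?q - l) \<le> 1 / 2 * ?N (?q - l') + ?N (l' - l)"
        unfolding power2_norm_eq_inner
        by (simp add: inner_diff_left inner_diff_right inner_add_left inner_add_right
            inner_commute algebra_simps)
    qed (use \<beta>0 in auto)
    finally show ?thesis by (simp add: algebra_simps)
  qed
  have quad: "\<beta> / 2 * (?N (a - y) - ?N (w - y)) - \<beta>' / 2 * ?N (a - w) - \<beta> / 4 * ?N (a - w)
      \<le> \<beta>\<^sup>2 / (2 * \<beta>' - \<beta>) * ?N (y - w)"
  proof -
    define c where "c = 2 * \<beta>' - \<beta>"
    have c: "0 < c" using \<beta> by (simp add: c_def)
    have "\<beta> / 2 * (?N (a - y) - ?N (w - y)) = \<beta> / 2 * ?N (a - w) + \<beta> * inner (a - w) (w - y)"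
      unfolding power2_norm_eq_inner
      by (simp add: inner_diff_left inner_diff_right inner_commute algebra_simps)
    then have "\<beta> / 2 * (?N (a - y) - ?N (w - y)) - \<beta>' / 2 * ?N (a - w) - \<beta> / 4 * ?N (a - w)
        = \<beta> * inner (a - w) (w - y) - c / 4 * ?N (a - w)"
      by (simp add: c_def algebra_simps add_divide_distrib diff_divide_distrib)
    moreover have "\<beta> * inner (a - w) (w - y) \<le> c / 4 * ?N (a - w) + \<beta>\<^sup>2 / c * ?N (w - y)"
    proof -
      \<comment> \<open>Young's inequality; the coefficient \<open>c\<close> of the remaining growth is positive by
        \<open>\<beta> < 2 \<beta>'\<close>.\<close>
      have "0 \<le> c / 4 * ?N ((a - w) - (2 * \<beta> / c) *\<^sub>R (w - y))" using c by simp
      also have "\<dots> = c / 4 * ?N (a - w) - \<beta> * inner (a - w) (w - y) + \<beta>\<^sup>2 / c * ?N (w - y)"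
      proof -
        have "?N (d - s *\<^sub>R f) = ?N d - 2 * s * inner d f + s\<^sup>2 * ?N f" for d f :: 'a and s
          unfolding power2_norm_eq_inner
          by (simp add: inner_diff_left inner_diff_right inner_commute power2_eq_square algebra_simps)
        from this[of "a - w" "2 * \<beta> / c" "w - y"] show ?thesis
          using c by (simp add: right_diff_distrib distrib_left power2_eq_square)
      qed
      finally show ?thesis by simp
    qed
    ultimately show ?thesis by (simp add: c_def norm_minus_commute)
  qed
  show ?thesis
    using growth change_w change_a quad unfolding sub_obj_def
    by (simp add: algebra_simps add_divide_distrib diff_divide_distrib)
qed

end

section \<open>The composite problem and its smoothing\<close>

lemma convex_edom:
  assumes "convex_fun_on S \<psi>" "\<And>x. x \<in> S \<Longrightarrow> \<psi> x \<noteq> -\<infinity>"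
  shows "convex_on (edom S \<psi>) (\<lambda>x. real_of_ereal (\<psi> x))"
proof -
  have fin: "\<psi> x = ereal (real_of_ereal (\<psi> x))" if "x \<in> edom S \<psi>" for x
    using that assms(2)[of x] by (cases "\<psi> x") (auto simp: edom_def)
  have comb: "u *\<^sub>R x + v *\<^sub>R y \<in> edom S \<psi> \<and>
      real_of_ereal (\<psi> (u *\<^sub>R x + v *\<^sub>R y)) \<le> u * real_of_ereal (\<psi> x) + v * real_of_ereal (\<psi> y)"
    if xy: "x \<in> edom S \<psi>" "y \<in> edom S \<psi>" and uv: "0 \<le> u" "0 \<le> v" "u + v = 1" for x y u v
  proof -
    have "(x, real_of_ereal (\<psi> x)) \<in> epi_on S \<psi>" "(y, real_of_ereal (\<psi> y)) \<in> epi_on S \<psi>"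
      using xy fin[OF xy(1), symmetric] fin[OF xy(2), symmetric] by (auto simp: epi_on_def edom_def)
    then have "u *\<^sub>R (x, real_of_ereal (\<psi> x)) + v *\<^sub>R (y, real_of_ereal (\<psi> y)) \<in> epi_on S \<psi>"
      using assms(1) uv unfolding convex_fun_on_def by (intro convexD)
    then have *: "u *\<^sub>R x + v *\<^sub>R y \<in> S"
      "\<psi> (u *\<^sub>R x + v *\<^sub>R y) \<le> ereal (u * real_of_ereal (\<psi> x) + v * real_of_ereal (\<psi> y))"
      by (auto simp: epi_on_def)
    then have "u *\<^sub>R x + v *\<^sub>R y \<in> edom S \<psi>" by (auto simp: edom_def)
    with *(2) fin[OF this] show ?thesis by (metis ereal_less_eq(3))
  qed
  show ?thesis
    unfolding convex_on_def convex_def using comb by blast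
qed

lemma norm_fst_snd_le: "norm (fst p) \<le> norm p" "norm (snd p) \<le> norm p"
  using norm_fst_le[of "fst p" "snd p"] norm_snd_le[of "snd p" "fst p"] by simp_all

text \<open>
  On the domains of \<open>g\<close> and of the conjugate all functions are finite, so the problem can be moved
  from extended to ordinary reals. The real counterparts are \<open>\<phi>\<close> (for \<open>f + g\<close>), \<open>hc\<close> (for the
  conjugate of \<open>h\<close>) and \<open>F\<close> (for the optimal value).
\<close>

locale composite_problem =
  fixes P :: problem and Lh :: real and xs :: rvec and ls :: "rvec \<times> rvec"
  assumes std: "standing_assms P Lh" and xs_opt: "primal_optimal P xs" and ls_opt: "dual_optimal P ls"
begin

definition \<phi> :: "rvec \<Rightarrow> real"
  where "\<phi> x = real_of_ereal (f_of P x) + real_of_ereal (g_of P x)"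

definition hc :: "rvec \<times> rvec \<Rightarrow> real" where "hc v = real_of_ereal (hconj P v)"

definition dom_h :: "(rvec \<times> rvec) set" where "dom_h = euclid (dim1 P) \<times> K_of P"

definition F :: real where "F = real_of_ereal (opt_value P)"

lemma dom_g_subset: "dom_g P \<subseteq> X_of P"
  by (auto simp: dom_g_def edom_def)

lemma f_not_MInf: "x \<in> X_of P \<Longrightarrow> f_of P x \<noteq> -\<infinity>"
  using std by (auto simp: standing_assms_def f_assms_def)

lemma g_not_MInf: "x \<in> X_of P \<Longrightarrow> g_of P x \<noteq> -\<infinity>"
  using std by (auto simp: standing_assms_def proper_on_def)

lemma f_finite: "x \<in> dom_g P \<Longrightarrow> f_of P x < \<infinity>"
  using std unfolding standing_assms_def f_assms_def by blast

lemma f_real: "x \<in> dom_g P \<Longrightarrow> f_of P x = ereal (real_of_ereal (f_of P x))"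
  using f_finite[of x] f_not_MInf[of x] dom_g_subset by (cases "f_of P x") auto

lemma g_real: "x \<in> dom_g P \<Longrightarrow> g_of P x = ereal (real_of_ereal (g_of P x))"
  using g_not_MInf[of x] dom_g_subset by (cases "g_of P x") (auto simp: dom_g_def edom_def)

lemma fg_real: "x \<in> dom_g P \<Longrightarrow> f_of P x + g_of P x = ereal (\<phi> x)"
  unfolding \<phi>_def plus_ereal.simps(1)[symmetric] by (simp only: f_real[symmetric] g_real[symmetric])

lemma fg_infinite: "x \<in> X_of P \<Longrightarrow> x \<notin> dom_g P \<Longrightarrow> f_of P x + g_of P x = \<infinity>"
  using f_not_MInf[of x] by (auto simp: dom_g_def edom_def)

lemma convex_phi: "convex_on (dom_g P) \<phi>"
proof -
  have g: "convex_on (dom_g P) (\<lambda>x. real_of_ereal (g_of P x))"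
    unfolding dom_g_def using std g_not_MInf by (intro convex_edom) (auto simp: standing_assms_def)
  have "convex_on (edom (X_of P) (f_of P)) (\<lambda>x. real_of_ereal (f_of P x))"
    using std f_not_MInf by (intro convex_edom) (auto simp: standing_assms_def f_assms_def)
  moreover have "dom_g P \<subseteq> edom (X_of P) (f_of P)"
    using dom_g_subset f_finite by (auto simp: edom_def)
  ultimately have f: "convex_on (dom_g P) (\<lambda>x. real_of_ereal (f_of P x))"
    using g convex_on_imp_convex convex_on_subset by blast
  show ?thesis using convex_on_add[OF f g] by (simp add: \<phi>_def[abs_def])
qed

lemma linear_mul_A: "linear (mul_A P)"
  unfolding mul_A_def[abs_def] mul_A1_def mul_A2_def
  by (rule linearI) (simp_all add: linear_mat_vec linear_add linear_scale)

lemma mul_A_in_Y: "mul_A P x \<in> Y_of P"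
  by (simp add: mul_A_def mul_A1_def mul_A2_def Y_of_def mat_vec_in_euclid)

lemma subspace_Y: "subspace (Y_of P)"
  unfolding Y_of_def by (intro subspace_Times subspace_euclid)

lemma dom_h_subset: "dom_h \<subseteq> Y_of P"
  using std by (auto simp: dom_h_def Y_of_def standing_assms_def)

lemma dom_h_nonempty: "dom_h \<noteq> {}"
  using std subspace_0[OF subspace_euclid] by (auto simp: dom_h_def standing_assms_def)

lemma h_sum_in: "u \<in> dom_h \<Longrightarrow> h_sum P u = ereal (h1_of P (fst u))"
  by (auto simp: h_sum_def dom_h_def set_indicator_def)

lemma h_sum_out: "u \<in> Y_of P \<Longrightarrow> u \<notin> dom_h \<Longrightarrow> h_sum P u = \<infinity>"
  by (auto simp: h_sum_def dom_h_def set_indicator_def Y_of_def)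

lemma hconj_eq: "hconj P v = (SUP u\<in>dom_h. ereal (inner v u - h1_of P (fst u)))"
  unfolding hconj_def conj_on_def
proof (rule antisym)
  show "(SUP u\<in>Y_of P. ereal (inner v u) - h_sum P u) \<le> (SUP u\<in>dom_h. ereal (inner v u - h1_of P (fst u)))"
  proof (rule SUP_least)
    fix u assume u: "u \<in> Y_of P"
    show "ereal (inner v u) - h_sum P u \<le> (SUP u\<in>dom_h. ereal (inner v u - h1_of P (fst u)))"
    proof (cases "u \<in> dom_h")
      case True
      then show ?thesis by (intro SUP_upper2[of u]) (simp_all add: h_sum_in)
    qed (simp add: h_sum_out u)
  qed
  show "(SUP u\<in>dom_h. ereal (inner v u - h1_of P (fst u))) \<le> (SUP u\<in>Y_of P. ereal (inner v u) - h_sum P u)"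
    using dom_h_subset by (intro SUP_mono) (auto simp: h_sum_in intro!: bexI)
qed

lemma hconj_not_MInf: "hconj P v \<noteq> -\<infinity>"
proof -
  obtain u where "u \<in> dom_h" using dom_h_nonempty by blast
  then have "ereal (inner v u - h1_of P (fst u)) \<le> hconj P v"
    unfolding hconj_eq by (intro SUP_upper)
  then show ?thesis by auto
qed

lemma hconj_real: "v \<in> dom_hconj P \<Longrightarrow> hconj P v = ereal (hc v)"
  using hconj_not_MInf[of v] by (cases "hconj P v") (auto simp: hc_def dom_hconj_def edom_def)

lemma hconj_infinite: "v \<in> Y_of P \<Longrightarrow> v \<notin> dom_hconj P \<Longrightarrow> hconj P v = \<infinity>"
  by (auto simp: dom_hconj_def edom_def)

lemma dom_hconj_subset: "dom_hconj P \<subseteq> Y_of P"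
  by (auto simp: dom_hconj_def edom_def)

lemma fenchel_young: "v \<in> dom_hconj P \<Longrightarrow> u \<in> dom_h \<Longrightarrow> inner v u - h1_of P (fst u) \<le> hc v"
  using SUP_upper[of u dom_h "\<lambda>u. ereal (inner v u - h1_of P (fst u))"] hconj_real[of v]
  by (simp add: hconj_eq)

lemma Lh_nonneg: "0 \<le> Lh"
  using std by (auto simp: standing_assms_def lipschitz_on_def)

lemma h1_lipschitz:
  "a \<in> euclid (dim1 P) \<Longrightarrow> b \<in> euclid (dim1 P) \<Longrightarrow> \<bar>h1_of P a - h1_of P b\<bar> \<le> Lh * norm (a - b)"
  using std unfolding standing_assms_def lipschitz_on_def by (auto simp: dist_norm)

lemma complete_dom_h: "Topological_Spaces.complete dom_h"
proof -
  have "Topological_Spaces.complete (euclid (dim2 P) \<inter> K_of P)"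
    using std by (intro complete_Int_closed complete_euclid) (auto simp: standing_assms_def)
  moreover have "euclid (dim2 P) \<inter> K_of P = K_of P" using std by (auto simp: standing_assms_def)
  ultimately have K: "Topological_Spaces.complete (K_of P)" by simp
  show ?thesis unfolding complete_def
  proof (intro allI impI)
    fix X :: "nat \<Rightarrow> rvec \<times> rvec"
    assume "(\<forall>k. X k \<in> dom_h) \<and> Cauchy X"
    then have X: "\<And>k. fst (X k) \<in> euclid (dim1 P)" "\<And>k. snd (X k) \<in> K_of P" and C: "Cauchy X"
      by (auto simp: dom_h_def mem_Times_iff)
    obtain a b where "a \<in> euclid (dim1 P)" "(\<lambda>k. fst (X k)) \<longlonglongrightarrow> a" "b \<in> K_of P" "(\<lambda>k. snd (X k)) \<longlonglongrightarrow> b"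
      using complete_euclid[of "dim1 P"] K X Cauchy_fst[OF C] Cauchy_snd[OF C]
      unfolding complete_def by meson
    then have "(a, b) \<in> dom_h" "X \<longlonglongrightarrow> (a, b)"
      using tendsto_Pair[of "\<lambda>k. fst (X k)" a sequentially "\<lambda>k. snd (X k)" b] by (auto simp: dom_h_def)
    then show "\<exists>l\<in>dom_h. X \<longlonglongrightarrow> l" by blast
  qed
qed

lemma convex_h: "convex_on dom_h (\<lambda>u. h1_of P (fst u))"
proof -
  have "edom (euclid (dim1 P)) (\<lambda>u. ereal (h1_of P u)) = euclid (dim1 P)"
    by (auto simp: edom_def)
  then have h1: "convex_on (euclid (dim1 P)) (h1_of P)"
    using convex_edom[of "euclid (dim1 P)" "\<lambda>u. ereal (h1_of P u)"] std
    by (simp add: standing_assms_def)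
  moreover have "convex dom_h"
    unfolding dom_h_def using std subspace_imp_convex[OF subspace_euclid]
    by (intro convex_Times) (auto simp: standing_assms_def)
  ultimately show ?thesis by (auto simp: convex_on_def dom_h_def mem_Times_iff)
qed

text \<open>
  By Moreau's decomposition, the proximal point of the conjugate is obtained from a proximal point
  \<open>z\<close> of \<open>h\<close> itself at \<open>u + \<beta> l\<close>. This direction gives the maximiser and at once its primal
  counterpart \<open>z = u + \<beta> (l - v)\<close> in the domain of \<open>h\<close>, with equality in the Fenchel-Young inequality;
  the accuracy estimates compare \<open>A x\<close> with this point.
\<close>

lemma Lam_exists:
  assumes u: "u \<in> Y_of P" and l: "l \<in> Y_of P" and \<beta>: "0 < \<beta>"
  shows "\<exists>v\<in>dom_hconj P. u + \<beta> *\<^sub>R (l - v) \<in> dom_h \<and>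
    hc v = inner v (u + \<beta> *\<^sub>R (l - v)) - h1_of P (fst (u + \<beta> *\<^sub>R (l - v)))"
proof -
  have "continuous_on (euclid (dim1 P)) (h1_of P)"
    using std lipschitz_on_continuous_on unfolding standing_assms_def by blast
  then have cont: "continuous_on dom_h (\<lambda>u. h1_of P (fst u))"
    by (rule continuous_on_compose2) (auto simp: dom_h_def intro!: continuous_intros)
  have low: "h1_of P 0 - Lh * norm z \<le> h1_of P (fst z)" if "z \<in> dom_h" for z
  proof -
    have "\<bar>h1_of P (fst z) - h1_of P 0\<bar> \<le> Lh * norm (fst z - 0)"
      using that subspace_0[OF subspace_euclid] by (intro h1_lipschitz) (auto simp: dom_h_def)
    also have "\<dots> \<le> Lh * norm z"
      by (intro mult_left_mono Lh_nonneg) (simp add: norm_fst_snd_le)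
    finally show ?thesis by simp
  qed
  obtain z where z: "z \<in> dom_h" and sub: "\<And>z'. z' \<in> dom_h \<Longrightarrow>
      h1_of P (fst z) + inner ((1 / \<beta>) *\<^sub>R (u + \<beta> *\<^sub>R l - z)) (z' - z) \<le> h1_of P (fst z')"
    using prox_point_exists[OF complete_dom_h dom_h_nonempty convex_h cont low Lh_nonneg \<beta>] by blast
  define v where "v = (1 / \<beta>) *\<^sub>R (u + \<beta> *\<^sub>R l - z)"
  have zv: "u + \<beta> *\<^sub>R (l - v) = z" using \<beta> by (simp add: v_def algebra_simps)
  have vY: "v \<in> Y_of P"
    unfolding v_def using u l z dom_h_subset subspace_Y
    by (intro subspace_scale subspace_diff subspace_add) auto
  have "hconj P v \<le> ereal (inner v z - h1_of P (fst z))"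
    unfolding hconj_eq
  proof (rule SUP_least)
    fix z' assume "z' \<in> dom_h"
    from sub[OF this, folded v_def]
    show "ereal (inner v z' - h1_of P (fst z')) \<le> ereal (inner v z - h1_of P (fst z))"
      by (simp add: inner_diff_right)
  qed
  moreover have "ereal (inner v z - h1_of P (fst z)) \<le> hconj P v"
    unfolding hconj_eq by (intro SUP_upper z)
  ultimately have "hconj P v = ereal (inner v z - h1_of P (fst z))" by simp
  then show ?thesis using vY z by (intro bexI[of _ v]) (auto simp: zv hc_def dom_hconj_def edom_def)
qed

text \<open>
  As \<open>v\<close> satisfies the Fenchel-Young equality with \<open>z = u + \<beta> (l - v)\<close>, the point \<open>z\<close> is a subgradient
  of \<open>hc\<close> at \<open>v\<close>, and completing squares in the subgradient inequality gives the growth.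
\<close>

lemma strong_max:
  assumes v: "v \<in> dom_hconj P" "u + \<beta> *\<^sub>R (l - v) \<in> dom_h"
    "hc v = inner v (u + \<beta> *\<^sub>R (l - v)) - h1_of P (fst (u + \<beta> *\<^sub>R (l - v)))"
    and v': "v' \<in> dom_hconj P"
  shows "inner v' u - hc v' - \<beta> / 2 * (norm (v' - l))\<^sup>2 + \<beta> / 2 * (norm (v' - v))\<^sup>2
     \<le> inner v u - hc v - \<beta> / 2 * (norm (v - l))\<^sup>2"
proof -
  have "inner v' (u + \<beta> *\<^sub>R (l - v)) - inner v (u + \<beta> *\<^sub>R (l - v)) + hc v \<le> hc v'"
    using fenchel_young[OF v' v(2)] v(3) by simp
  then show ?thesis
    unfolding power2_norm_eq_inner
    by (simp add: inner_diff_left inner_diff_right inner_add_right inner_commute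
        algebra_simps add_divide_distrib diff_divide_distrib)
qed

lemma smooth_obj_in:
  "v \<in> dom_hconj P \<Longrightarrow> smooth_obj P u l \<beta> v = ereal (inner v u - hc v - \<beta> / 2 * (norm (v - l))\<^sup>2)"
  by (simp add: smooth_obj_def hconj_real)

lemma smooth_obj_out: "v \<in> Y_of P \<Longrightarrow> v \<notin> dom_hconj P \<Longrightarrow> smooth_obj P u l \<beta> v = -\<infinity>"
  by (simp add: smooth_obj_def hconj_infinite)

lemma Lam_eqI:
  assumes v: "v \<in> dom_hconj P" "u + \<beta> *\<^sub>R (l - v) \<in> dom_h"
    "hc v = inner v (u + \<beta> *\<^sub>R (l - v)) - h1_of P (fst (u + \<beta> *\<^sub>R (l - v)))" and \<beta>: "0 < \<beta>"
  shows "Lam P u l \<beta> = v"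
    and "h_smooth P u l \<beta> = ereal (inner v u - hc v - \<beta> / 2 * (norm (v - l))\<^sup>2)"
proof -
  have vY: "v \<in> Y_of P" using v dom_hconj_subset by blast
  have le: "smooth_obj P u l \<beta> v' \<le> smooth_obj P u l \<beta> v" if "v' \<in> Y_of P" for v'
  proof (cases "v' \<in> dom_hconj P")
    case True
    have "0 \<le> \<beta> / 2 * (norm (v' - v))\<^sup>2" using \<beta> by simp
    then show ?thesis using strong_max[OF v(1-3) True] v(1) True by (simp add: smooth_obj_in)
  qed (simp add: smooth_obj_out that)
  show "h_smooth P u l \<beta> = ereal (inner v u - hc v - \<beta> / 2 * (norm (v - l))\<^sup>2)"
    unfolding h_smooth_def smooth_obj_in[OF v(1), symmetric]
    by (rule antisym) (auto intro: SUP_least SUP_upper le vY)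
  show "Lam P u l \<beta> = v"
    unfolding Lam_def
  proof (rule the_equality)
    show "is_arg_max (smooth_obj P u l \<beta>) (\<lambda>v. v \<in> Y_of P) v"
      using vY le by (auto simp: is_arg_max_def not_less)
  next
    fix v' assume "is_arg_max (smooth_obj P u l \<beta>) (\<lambda>v. v \<in> Y_of P) v'"
    then have v'Y: "v' \<in> Y_of P" and ge: "smooth_obj P u l \<beta> v \<le> smooth_obj P u l \<beta> v'"
      using vY unfolding is_arg_max_def by (blast, metis not_less)
    have v': "v' \<in> dom_hconj P"
      using ge v(1) v'Y smooth_obj_out[OF v'Y] by (cases "v' \<in> dom_hconj P") (auto simp: smooth_obj_in)
    have "\<beta> / 2 * (norm (v' - v))\<^sup>2 \<le> 0"
      using ge strong_max[OF v(1-3) v'] v(1) v' by (simp add: smooth_obj_in)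
    then show "v' = v" using \<beta> by (simp add: mult_le_0_iff)
  qed
qed

lemma Lam_props:
  assumes "u \<in> Y_of P" "l \<in> Y_of P" "0 < \<beta>"
  shows "Lam P u l \<beta> \<in> dom_hconj P"
    and "u + \<beta> *\<^sub>R (l - Lam P u l \<beta>) \<in> dom_h"
    and "hc (Lam P u l \<beta>) = inner (Lam P u l \<beta>) (u + \<beta> *\<^sub>R (l - Lam P u l \<beta>))
           - h1_of P (fst (u + \<beta> *\<^sub>R (l - Lam P u l \<beta>)))"
    and "h_smooth P u l \<beta> = ereal (inner (Lam P u l \<beta>) u - hc (Lam P u l \<beta>)
           - \<beta> / 2 * (norm (Lam P u l \<beta> - l))\<^sup>2)"
proof -
  obtain v where v: "v \<in> dom_hconj P" "u + \<beta> *\<^sub>R (l - v) \<in> dom_h"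
    "hc v = inner v (u + \<beta> *\<^sub>R (l - v)) - h1_of P (fst (u + \<beta> *\<^sub>R (l - v)))"
    using Lam_exists[OF assms] by blast
  then show "Lam P u l \<beta> \<in> dom_hconj P"
    and "u + \<beta> *\<^sub>R (l - Lam P u l \<beta>) \<in> dom_h"
    and "hc (Lam P u l \<beta>) = inner (Lam P u l \<beta>) (u + \<beta> *\<^sub>R (l - Lam P u l \<beta>))
           - h1_of P (fst (u + \<beta> *\<^sub>R (l - Lam P u l \<beta>)))"
    and "h_smooth P u l \<beta> = ereal (inner (Lam P u l \<beta>) u - hc (Lam P u l \<beta>)
           - \<beta> / 2 * (norm (Lam P u l \<beta> - l))\<^sup>2)"
    using Lam_eqI[OF v assms(3)] by simp_all
qed

lemma objective_real: "x \<in> dom_g P \<Longrightarrow> objective P x = ereal (\<phi> x + h1_of P (mul_A1 P x))"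
  by (simp add: objective_def fg_real)

lemma lagr_real:
  "x \<in> dom_g P \<Longrightarrow> l \<in> dom_hconj P \<Longrightarrow> lagr P x l = ereal (\<phi> x + inner l (mul_A P x) - hc l)"
  by (simp add: lagr_def fg_real hconj_real)

lemma feasible_in_dom_h: "x \<in> feasible P \<Longrightarrow> mul_A P x \<in> dom_h"
  by (simp add: feasible_def dom_h_def mul_A_def mul_A1_def mat_vec_in_euclid)

text \<open>
  Strong duality is assumed for one pair of solutions only. As optimal values do not depend on the
  solution, it carries over to the given pair \<open>(xs, ls)\<close>, which in particular lies in the domains.
\<close>

lemma saddle_values:
  "opt_value P = ereal F" "xs \<in> dom_g P" "ls \<in> dom_hconj P" "dual_fun P ls = ereal F"
proof -
  obtain x l where xl: "x \<in> dom_g P" "l \<in> dom_hconj P" "primal_optimal P x" "dual_optimal P l"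
    "objective P x = lagr P x l" "lagr P x l = dual_fun P l"
    using std unfolding standing_assms_def by blast
  show opt: "opt_value P = ereal F"
    using xl(3) objective_real[OF xl(1)] unfolding F_def primal_optimal_def by (metis real_of_ereal.simps(1))
  have xsX: "xs \<in> X_of P" using xs_opt by (simp add: primal_optimal_def feasible_def)
  show "xs \<in> dom_g P"
  proof (rule ccontr)
    assume "xs \<notin> dom_g P"
    then have "objective P xs = \<infinity>" using fg_infinite[OF xsX] unfolding objective_def by auto
    then show False using xs_opt opt by (simp add: primal_optimal_def)
  qed
  show dual: "dual_fun P ls = ereal F"
    using xl(3-6) ls_opt opt by (simp add: dual_optimal_def primal_optimal_def)
  show "ls \<in> dom_hconj P"
  proof (rule ccontr)
    assume "ls \<notin> dom_hconj P"
    then have "hconj P ls = \<infinity>" using ls_opt by (intro hconj_infinite) (auto simp: dual_optimal_def)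
    then have "lagr P x ls = -\<infinity>" by (simp add: lagr_def fg_real[OF xl(1)])
    moreover have "dual_fun P ls \<le> lagr P x ls"
      unfolding dual_fun_def using xl(1) dom_g_subset by (intro INF_lower) auto
    ultimately show False using dual by simp
  qed
qed

end

sublocale composite_problem \<subseteq>
  smoothed_saddle_point "dom_g P" \<phi> "mul_A P" "dom_hconj P" hc "Lam P" xs ls F
proof (intro smoothed_saddle_point.intro smoothed_saddle.intro smoothed_saddle_point_axioms.intro)
  show "convex_on (dom_g P) \<phi>" by (rule convex_phi)
  show "linear (mul_A P)" by (rule linear_mul_A)
  show "xs \<in> dom_g P" "ls \<in> dom_hconj P" by (rule saddle_values)+
  fix x l \<beta> assume l: "l \<in> dom_hconj P" and \<beta>: "0 < (\<beta> :: real)"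
  note Lam = Lam_props[OF mul_A_in_Y[of x] subsetD[OF dom_hconj_subset l] \<beta>]
  show "Lam P (mul_A P x) l \<beta> \<in> dom_hconj P" by (rule Lam)
  fix v assume "v \<in> dom_hconj P"
  then show "inner v (mul_A P x) - hc v - \<beta> / 2 * (norm (v - l))\<^sup>2
      + \<beta> / 2 * (norm (v - Lam P (mul_A P x) l \<beta>))\<^sup>2
    \<le> inner (Lam P (mul_A P x) l \<beta>) (mul_A P x) - hc (Lam P (mul_A P x) l \<beta>)
      - \<beta> / 2 * (norm (Lam P (mul_A P x) l \<beta> - l))\<^sup>2"
    by (rule strong_max[OF Lam(1-3)])
next
  fix a assume a: "a \<in> dom_g P"
  have "dual_fun P ls \<le> lagr P a ls"
    unfolding dual_fun_def using a dom_g_subset by (intro INF_lower) auto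
  then show "F \<le> \<phi> a + inner ls (mul_A P a) - hc ls"
    using saddle_values a by (simp add: lagr_real)
next
  fix v assume v: "v \<in> dom_hconj P"
  have xs: "xs \<in> feasible P" "objective P xs = ereal F"
    using xs_opt saddle_values by (auto simp: primal_optimal_def)
  then have "\<phi> xs + h1_of P (mul_A1 P xs) = F"
    using saddle_values by (simp add: objective_real)
  then show "\<phi> xs + inner v (mul_A P xs) - hc v \<le> F"
    using fenchel_young[OF v feasible_in_dom_h[OF xs(1)]] by (simp add: mul_A_def)
qed

context composite_problem
begin

lemma lagr_smooth_real:
  assumes "x \<in> dom_g P" "l \<in> dom_hconj P" "0 < \<beta>"
  shows "lagr_smooth P x y l \<beta> = ereal (sub_obj y l \<beta> x)"
  using Lam_props(4)[OF mul_A_in_Y[of x] subsetD[OF dom_hconj_subset assms(2)] assms(3)] assms(1)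
  by (simp add: lagr_smooth_def sub_obj_def smooth_def fg_real)

lemma lagr_smooth_infinite:
  assumes "x \<in> X_of P" "x \<notin> dom_g P" "l \<in> dom_hconj P" "0 < \<beta>"
  shows "lagr_smooth P x y l \<beta> = \<infinity>"
  using Lam_props(4)[OF mul_A_in_Y[of x] subsetD[OF dom_hconj_subset assms(3)] assms(4)] assms(1,2)
  by (simp add: lagr_smooth_def fg_infinite)

lemma objective_diff:
  "x \<in> dom_g P \<Longrightarrow> real_of_ereal (objective P x - opt_value P) = \<phi> x + h1_of P (mul_A1 P x) - F"
  by (simp add: objective_real saddle_values(1))

text \<open>
  The point \<open>z = A w + \<beta> (l - l')\<close> lies in the domain of \<open>h\<close>, so its second block is feasible, and its
  distance to \<open>A w\<close> is \<open>\<beta> \<parallel>l' - l\<parallel>\<close>. This is the bound for the infeasibility. For the objective, the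
  upper bound compares \<open>w\<close> with \<open>xs\<close> in the subproblem, and the lower bound is weak duality with the
  multiplier \<open>ls\<close>, corrected for the infeasibility.
\<close>

lemma near_min_accuracy:
  assumes w: "near_min y l \<beta> e w" and l: "l \<in> dom_hconj P" and \<beta>: "0 < \<beta>"
    and l': "l' = Lam P (mul_A P w) l \<beta>"
  shows "infdist (mul_A2 P w) (K_of P) \<le> \<beta> * norm (l' - l)"
    and "\<phi> w + h1_of P (mul_A1 P w) - F
      \<le> e + \<beta> / 2 * (norm (xs - y))\<^sup>2 + \<beta> / 2 * (norm l)\<^sup>2 + Lh * \<beta> * norm (l' - l)"
    and "F - \<beta> * norm ls * norm (l' - l) \<le> \<phi> w + h1_of P (mul_A1 P w)"
proof -
  have wC: "w \<in> dom_g P" using w by (simp add: near_min_def)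
  define z where "z = mul_A P w + \<beta> *\<^sub>R (l - l')"
  note Lam = Lam_props[OF mul_A_in_Y[of w] subsetD[OF dom_hconj_subset l] \<beta>,
    folded l', folded z_def]
  have z: "fst z \<in> euclid (dim1 P)" "snd z \<in> K_of P" using Lam(2) by (auto simp: dom_h_def)
  have fz: "mul_A1 P w - fst z = \<beta> *\<^sub>R fst (l' - l)" and sz: "mul_A2 P w - snd z = \<beta> *\<^sub>R snd (l' - l)"
    by (auto simp: z_def mul_A_def algebra_simps)
  have "infdist (mul_A2 P w) (K_of P) \<le> dist (mul_A2 P w) (snd z)"
    using z(2) by (rule infdist_le)
  also have "\<dots> = \<beta> * norm (snd (l' - l))" unfolding dist_norm sz using \<beta> by simp
  also have "\<dots> \<le> \<beta> * norm (l' - l)"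
    using \<beta> norm_fst_snd_le(2)[of "l' - l"] by (intro mult_left_mono) auto
  finally show "infdist (mul_A2 P w) (K_of P) \<le> \<beta> * norm (l' - l)" .
  have A1w: "mul_A1 P w \<in> euclid (dim1 P)" by (simp add: mul_A1_def mat_vec_in_euclid)
  have "\<bar>h1_of P (mul_A1 P w) - h1_of P (fst z)\<bar> \<le> Lh * norm (mul_A1 P w - fst z)"
    by (rule h1_lipschitz[OF A1w z(1)])
  also have "\<dots> = Lh * \<beta> * norm (fst (l' - l))" unfolding fz using \<beta> by simp
  also have "\<dots> \<le> Lh * \<beta> * norm (l' - l)"
    using \<beta> Lh_nonneg norm_fst_snd_le(1)[of "l' - l"] by (intro mult_left_mono) auto
  finally have h1z: "h1_of P (mul_A1 P w) \<le> h1_of P (fst z) + Lh * \<beta> * norm (l' - l)" by simp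
  have smooth_w: "smooth l \<beta> w = h1_of P (fst z) + \<beta> / 2 * (norm l')\<^sup>2 - \<beta> / 2 * (norm l)\<^sup>2"
    unfolding smooth_def l'[symmetric] Lam(3) unfolding z_def power2_norm_eq_inner
    by (simp add: inner_diff_left inner_diff_right inner_add_right inner_commute
        algebra_simps add_divide_distrib diff_divide_distrib)
  have "sub_obj y l \<beta> w \<le> sub_obj y l \<beta> xs + e" using w xs by (simp add: near_min_def)
  moreover have "\<phi> xs + smooth l \<beta> xs \<le> F"
  proof -
    have "0 \<le> \<beta> / 2 * (norm (Lam P (mul_A P xs) l \<beta> - l))\<^sup>2" using \<beta> by simp
    then show ?thesis using saddle_l[OF prox_in[OF xs l \<beta>]] unfolding smooth_def by linarith
  qed
  moreover have "0 \<le> \<beta> / 2 * (norm l')\<^sup>2" "0 \<le> \<beta> / 2 * (norm (w - y))\<^sup>2" using \<beta> by auto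
  ultimately show "\<phi> w + h1_of P (mul_A1 P w) - F
      \<le> e + \<beta> / 2 * (norm (xs - y))\<^sup>2 + \<beta> / 2 * (norm l)\<^sup>2 + Lh * \<beta> * norm (l' - l)"
    using h1z smooth_w unfolding sub_obj_def by linarith
  have "(mul_A1 P w, snd z) \<in> dom_h" using A1w z by (simp add: dom_h_def)
  then have "inner ls (mul_A1 P w, snd z) - h1_of P (mul_A1 P w) \<le> hc ls"
    using fenchel_young[OF ls] by fastforce
  moreover have "F \<le> \<phi> w + inner ls (mul_A P w) - hc ls" by (rule saddle_x[OF wC])
  moreover have "inner ls (mul_A P w) - inner ls (mul_A1 P w, snd z) \<le> \<beta> * norm ls * norm (l' - l)"
  proof -
    have "inner ls (mul_A P w) - inner ls (mul_A1 P w, snd z) = inner ls (0, \<beta> *\<^sub>R snd (l' - l))"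
      unfolding sz[symmetric] mul_A_def by (simp add: inner_diff_right[symmetric])
    also have "\<dots> \<le> norm ls * norm (0 :: rvec, \<beta> *\<^sub>R snd (l' - l))" by (rule norm_cauchy_schwarz)
    also have "\<dots> = norm ls * (\<beta> * norm (snd (l' - l)))" using \<beta> by (simp add: norm_Pair)
    also have "\<dots> \<le> norm ls * (\<beta> * norm (l' - l))"
      using \<beta> norm_fst_snd_le(2)[of "l' - l"] by (intro mult_left_mono) auto
    finally show ?thesis by (simp add: algebra_simps)
  qed
  ultimately show "F - \<beta> * norm ls * norm (l' - l) \<le> \<phi> w + h1_of P (mul_A1 P w)" by linarith
qed

end

section \<open>The outer iterates\<close>

text \<open>
  After \<open>n\<close> full periods of length \<open>\<kappa>\<close> the required reduction has been reached, so the least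
  admissible number of inner iterations is at most \<open>\<kappa> n\<close>, rounded up.
\<close>

lemma restart_count:
  fixes \<kappa> B e :: real and n :: nat
  assumes \<kappa>: "1 \<le> \<kappa>" and e: "0 < e" and n: "0 < n" "B \<le> 2 ^ n * e / 2"
  defines "m \<equiv> LEAST k :: nat. 0 < k \<and> B \<le> 2 powi \<lfloor>real k / \<kappa>\<rfloor> * e / 2"
  shows "B \<le> 2 powi \<lfloor>real m / \<kappa>\<rfloor> * e / 2" "real m \<le> \<kappa> * real n + 1"
proof -
  define k where "k = nat \<lceil>\<kappa> * real n\<rceil>"
  have pos: "0 < \<kappa> * real n" using \<kappa> n by simp
  have k: "\<kappa> * real n \<le> real k" "real k \<le> \<kappa> * real n + 1" using pos unfolding k_def by linarith+
  have "int n \<le> \<lfloor>real k / \<kappa>\<rfloor>"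
    using k(1) \<kappa> by (simp add: le_floor_iff field_simps)
  then have "(2 :: real) ^ n \<le> 2 powi \<lfloor>real k / \<kappa>\<rfloor>"
    using power_int_increasing[of "int n" "\<lfloor>real k / \<kappa>\<rfloor>" "2 :: real"] by simp
  then have "2 ^ n * e / 2 \<le> 2 powi \<lfloor>real k / \<kappa>\<rfloor> * e / 2" using e by simp
  then have witness: "0 < k \<and> B \<le> 2 powi \<lfloor>real k / \<kappa>\<rfloor> * e / 2"
    using pos k(1) n(2) by auto
  show "B \<le> 2 powi \<lfloor>real m / \<kappa>\<rfloor> * e / 2"
    using LeastI[where P = "\<lambda>k. 0 < k \<and> B \<le> 2 powi \<lfloor>real k / \<kappa>\<rfloor> * e / 2", OF witness]
    unfolding m_def by blast
  have "m \<le> k" unfolding m_def by (rule Least_le) (rule witness)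
  then show "real m \<le> \<kappa> * real n + 1" using k(2) by linarith
qed

text \<open>
  A run for a fixed sample point. Everything below is deterministic: the guarantee for the solver holds
  at every sample point, so the bounds on the iterates need no averaging.
\<close>

locale ipalm = composite_problem P Lh xs ls
  for P :: problem and Lh :: real and xs :: rvec and ls :: "rvec \<times> rvec" +
  fixes \<beta>0 \<rho> \<epsilon>0 \<eta> Lf \<mu>g :: real and m0 :: nat and xi :: rvec and li :: "rvec \<times> rvec"
    and \<kappa> :: "nat \<Rightarrow> real" and \<A> :: solver
    and x :: "nat \<Rightarrow> rvec" and l :: "nat \<Rightarrow> rvec \<times> rvec" and m :: "nat \<Rightarrow> nat"
  assumes params: "1 / 2 < \<rho>" "\<rho> < 1" "0 < \<eta>" "\<eta> < \<rho>" "0 < \<beta>0" "0 < \<epsilon>0"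
    and xi: "xi \<in> dom_g P" and li: "li \<in> dom_hconj P"
    and run: "ipalm_run P Lh \<A> \<kappa> \<beta>0 \<rho> \<epsilon>0 \<eta> m0 xi li x l m"
    and apg: "apg_guarantee P Lf \<mu>g \<A> \<kappa> \<beta>0 \<rho> xi x l"
begin

definition \<beta> :: "nat \<Rightarrow> real" where "\<beta> = (\<lambda>s. \<beta>0 * \<rho> ^ s)"

definition e :: "nat \<Rightarrow> real" where "e = (\<lambda>s. \<epsilon>0 * \<eta> ^ s)"

abbreviation prev :: "nat \<Rightarrow> rvec" where "prev \<equiv> prev_iterate xi x"

abbreviation M :: "nat \<Rightarrow> real" where "M \<equiv> M_term P Lh \<beta> xi x l"

lemma prev_simps [simp]: "prev 0 = xi" "prev (Suc s) = x s"
  by (simp_all add: prev_iterate_def)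

lemma beta_pos: "0 < \<beta> s" and e_pos: "0 < e s"
  using params by (simp_all add: \<beta>_def e_def)

lemma beta_Suc: "\<beta> (Suc s) = \<rho> * \<beta> s"
  by (simp add: \<beta>_def)

lemma run_facts:
  "l 0 = li" "m 0 = m0" "x s = \<A> (prev s) (m s) (subproblem P \<beta> xi x l s)"
  "subproblem P \<beta> xi x l 0 (x 0) - subproblem_opt P \<beta> xi x l 0 \<le> ereal \<epsilon>0"
  "l (Suc s) = Lam P (mul_A P (x s)) (l s) (\<beta> s)"
  "m (Suc s) = (LEAST k. 0 < k \<and> 2 * e s + M s \<le> 2 powi \<lfloor>real k / \<kappa> (Suc s)\<rfloor> * e (Suc s) / 2)"
  using run unfolding ipalm_run_def Let_def \<beta>_def e_def by blast+

lemma apg_facts: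
  "1 \<le> \<kappa> s" "\<kappa> s \<le> 2 * sqrt (2 * (Lf + (normA P)\<^sup>2 / \<beta> s) / (\<mu>g + \<beta> s)) + 1"
  "z \<in> dom_g P \<Longrightarrow> \<A> z k (subproblem P \<beta> xi x l s) \<in> X_of P"
  "z \<in> dom_g P \<Longrightarrow> subproblem P \<beta> xi x l s (\<A> z k (subproblem P \<beta> xi x l s)) - subproblem_opt P \<beta> xi x l s
     \<le> ereal (2 powi (- \<lfloor>real k / \<kappa> s\<rfloor>)) * (subproblem P \<beta> xi x l s z - subproblem_opt P \<beta> xi x l s)"
  using apg unfolding apg_guarantee_def Let_def \<beta>_def by blast+

lemma subproblem_real:
  "l s \<in> dom_hconj P \<Longrightarrow> z \<in> dom_g P \<Longrightarrow>
    subproblem P \<beta> xi x l s z = ereal (sub_obj (prev s) (l s) (\<beta> s) z)"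
  by (simp add: subproblem_def lagr_smooth_real beta_pos)

lemma subproblem_infinite:
  "l s \<in> dom_hconj P \<Longrightarrow> z \<in> X_of P \<Longrightarrow> z \<notin> dom_g P \<Longrightarrow> subproblem P \<beta> xi x l s z = \<infinity>"
  by (simp add: subproblem_def lagr_smooth_infinite beta_pos)

text \<open>
  A solver output with finite excess has a finite objective value, hence lies in the domain of \<open>g\<close>.
\<close>

lemma near_minI:
  assumes l: "l s \<in> dom_hconj P" and w: "w \<in> X_of P" and opt: "subproblem_opt P \<beta> xi x l s = ereal opt"
    and le: "subproblem P \<beta> xi x l s w - ereal opt \<le> ereal r"
  shows "near_min (prev s) (l s) (\<beta> s) r w"
proof -
  have wC: "w \<in> dom_g P" using le subproblem_infinite[OF l w] by (cases "w \<in> dom_g P") auto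
  have "sub_obj (prev s) (l s) (\<beta> s) w \<le> sub_obj (prev s) (l s) (\<beta> s) a + r" if a: "a \<in> dom_g P" for a
  proof -
    have "ereal opt \<le> subproblem P \<beta> xi x l s a"
      unfolding opt[symmetric] subproblem_opt_def using a dom_g_subset by (intro INF_lower) auto
    then show ?thesis using le by (simp add: subproblem_real l a wC)
  qed
  with wC show ?thesis by (simp add: near_min_def)
qed

lemma subproblem_opt_le:
  "l s \<in> dom_hconj P \<Longrightarrow> z \<in> dom_g P \<Longrightarrow>
    subproblem_opt P \<beta> xi x l s \<le> ereal (sub_obj (prev s) (l s) (\<beta> s) z)"
  unfolding subproblem_opt_def using dom_g_subset
  by (intro INF_lower2[of z]) (auto simp: subproblem_real)

lemma near_min_initial: "near_min (prev 0) (l 0) (\<beta> 0) (e 0) (x 0)"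
proof -
  have l0: "l 0 \<in> dom_hconj P" using li run_facts(1) by simp
  have x0: "x 0 \<in> X_of P" using apg_facts(3)[of xi "m 0" 0] xi run_facts(3)[of 0] by simp
  have "subproblem P \<beta> xi x l 0 (x 0) \<noteq> -\<infinity>"
    using subproblem_real[OF l0, of "x 0"] subproblem_infinite[OF l0 x0] by (cases "x 0 \<in> dom_g P") auto
  then obtain opt where opt: "subproblem_opt P \<beta> xi x l 0 = ereal opt"
    using run_facts(4) subproblem_opt_le[OF l0 xi] by (cases "subproblem_opt P \<beta> xi x l 0") auto
  show ?thesis
    by (rule near_minI[OF l0 x0 opt]) (use run_facts(4) opt in \<open>simp add: e_def\<close>)
qed

text \<open>
  The bound on the excess of the starting point also shows that the optimal value of the subproblem
  is finite; only then can the guarantee for the solver, stated with extended reals, be read as an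
  inequality between reals.
\<close>

lemma near_min_after_solve:
  assumes l: "l s \<in> dom_hconj P" and prev: "prev s \<in> dom_g P"
    and warm: "\<And>a. a \<in> dom_g P \<Longrightarrow>
      sub_obj (prev s) (l s) (\<beta> s) (prev s) \<le> sub_obj (prev s) (l s) (\<beta> s) a + B"
    and B: "2 powi (- \<lfloor>real (m s) / \<kappa> s\<rfloor>) * B \<le> r"
  shows "near_min (prev s) (l s) (\<beta> s) r (x s)"
proof -
  let ?H = "sub_obj (prev s) (l s) (\<beta> s)" and ?q = "2 powi (- \<lfloor>real (m s) / \<kappa> s\<rfloor>) :: real"
  have xs: "x s \<in> X_of P" using apg_facts(3)[OF prev, of "m s" s] run_facts(3)[of s] by simp
  have low: "ereal (?H (prev s) - B) \<le> subproblem_opt P \<beta> xi x l s"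
    unfolding subproblem_opt_def
  proof (rule INF_greatest)
    fix z assume z: "z \<in> X_of P"
    show "ereal (?H (prev s) - B) \<le> subproblem P \<beta> xi x l s z"
      using warm[of z] subproblem_real[OF l, of z] subproblem_infinite[OF l z]
      by (cases "z \<in> dom_g P") (auto simp: algebra_simps)
  qed
  then obtain opt where opt: "subproblem_opt P \<beta> xi x l s = ereal opt"
    using subproblem_opt_le[OF l prev] by (cases "subproblem_opt P \<beta> xi x l s") auto
  have "subproblem P \<beta> xi x l s (x s) - ereal opt \<le> ereal ?q * (ereal (?H (prev s)) - ereal opt)"
    using apg_facts(4)[OF prev, of s "m s"] run_facts(3)[of s] by (simp add: opt subproblem_real l prev)
  also have "\<dots> \<le> ereal r"
  proof -
    have "?q * (?H (prev s) - opt) \<le> ?q * B"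
      using low opt by (intro mult_left_mono) auto
    also have "\<dots> \<le> r" by (rule B)
    finally show ?thesis by simp
  qed
  finally show ?thesis by (rule near_minI[OF l xs opt])
qed

text \<open>
  The first three terms of \<open>M\<close> are those of \<open>warm_start\<close>, except that the first one has the factor
  \<open>3/2\<close> there. The outer factor \<open>2\<close> absorbs the difference.
\<close>

lemma warm_start_M:
  assumes l: "l s \<in> dom_hconj P" and min: "near_min (prev s) (l s) (\<beta> s) (e s) (x s)" and a: "a \<in> dom_g P"
  shows "sub_obj (x s) (l (Suc s)) (\<beta> (Suc s)) (x s)
    \<le> sub_obj (x s) (l (Suc s)) (\<beta> (Suc s)) a + 2 * (2 * e s + M s)"
proof -
  have \<beta>: "\<beta> (Suc s) \<le> \<beta> s" "\<beta> s < 2 * \<beta> (Suc s)"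
    using params beta_pos[of s] unfolding beta_Suc by auto
  let ?t1 = "\<beta> s * (norm (l (Suc s) - l s))\<^sup>2"
  let ?t2 = "(\<beta> s - \<beta> (Suc s)) / 2 * (norm (Lam P (mul_A P (x s)) (l (Suc s)) (\<beta> (Suc s)) - l (Suc s)))\<^sup>2"
  let ?t3 = "(\<beta> s)\<^sup>2 / (2 * \<beta> (Suc s) - \<beta> s) * (norm (prev s - x s))\<^sup>2"
  have M: "?t1 + ?t2 + ?t3 \<le> M s" unfolding M_term_def by simp
  have t: "0 \<le> ?t1" "0 \<le> ?t2" "0 \<le> ?t3"
    using \<beta> beta_pos[of s] by (auto intro!: mult_nonneg_nonneg divide_nonneg_nonneg)
  have "sub_obj (x s) (l (Suc s)) (\<beta> (Suc s)) (x s)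
    \<le> sub_obj (x s) (l (Suc s)) (\<beta> (Suc s)) a + 2 * e s
      + 3 / 2 * \<beta> s * (norm (l (Suc s) - l s))\<^sup>2 + ?t2 + ?t3"
    using warm_start[OF min a l beta_pos \<beta> run_facts(5)] .
  then show ?thesis using M t e_pos[of s] by simp
qed

lemma restart_exponent_exists: "\<exists>n. 0 < n \<and> 2 * e s + M s \<le> 2 ^ n * e (Suc s) / 2"
proof -
  obtain k where k: "(2 * e s + M s) * 2 / e (Suc s) < 2 ^ k"
    using real_arch_pow[of 2] by auto
  also have "(2 :: real) ^ k \<le> 2 ^ Suc k" by simp
  finally have "2 * e s + M s \<le> 2 ^ Suc k * e (Suc s) / 2"
    using e_pos[of "Suc s"] by (simp add: field_simps)
  then show ?thesis by blast
qed

text \<open>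
  The induction couples three statements: an accurate \<open>x s\<close> makes the next subproblem start well,
  by \<open>warm_start_M\<close>, and the choice of the number of inner iterations turns this into accuracy of
  \<open>x (Suc s)\<close>.
\<close>

theorem near_min_all:
  "l s \<in> dom_hconj P \<and> prev s \<in> dom_g P \<and> near_min (prev s) (l s) (\<beta> s) (e s) (x s)"
proof (induction s)
  case 0
  then show ?case using near_min_initial li xi by (simp add: run_facts(1))
next
  case (Suc s)
  then have l: "l s \<in> dom_hconj P" and min: "near_min (prev s) (l s) (\<beta> s) (e s) (x s)" by auto
  have xsC: "x s \<in> dom_g P" using min by (simp add: near_min_def)
  have l': "l (Suc s) \<in> dom_hconj P"
    unfolding run_facts(5) by (rule prox_in[OF xsC l beta_pos])
  obtain n where n: "0 < n" "2 * e s + M s \<le> 2 ^ n * e (Suc s) / 2"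
    using restart_exponent_exists by blast
  have m: "2 * e s + M s \<le> 2 powi \<lfloor>real (m (Suc s)) / \<kappa> (Suc s)\<rfloor> * e (Suc s) / 2"
    unfolding run_facts(6) by (rule restart_count(1)[OF apg_facts(1) e_pos n])
  have "near_min (prev (Suc s)) (l (Suc s)) (\<beta> (Suc s)) (e (Suc s)) (x (Suc s))"
  proof (rule near_min_after_solve[where B = "2 * (2 * e s + M s)"])
    show "2 powi - \<lfloor>real (m (Suc s)) / \<kappa> (Suc s)\<rfloor> * (2 * (2 * e s + M s)) \<le> e (Suc s)"
      using m by (simp add: power_int_minus field_simps)
    show "sub_obj (prev (Suc s)) (l (Suc s)) (\<beta> (Suc s)) (prev (Suc s))
        \<le> sub_obj (prev (Suc s)) (l (Suc s)) (\<beta> (Suc s)) a + 2 * (2 * e s + M s)"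
      if "a \<in> dom_g P" for a
      using warm_start_M[OF l min that] by simp
  qed (use l' xsC in auto)
  then show ?case using l' xsC by simp
qed

lemmas l_in = near_min_all[THEN conjunct1]
lemmas x_near_min = near_min_all[THEN conjunct2, THEN conjunct2]

lemma x_in: "x s \<in> dom_g P"
  using x_near_min[of s] by (simp add: near_min_def)

abbreviation "c0 \<equiv> const0 \<beta>0 \<rho> \<epsilon>0 \<eta> xi li xs ls"

text \<open>
  The increments \<open>sqrt (2 \<epsilon>\<^sub>s / \<beta>\<^sub>s)\<close> of the distance to the saddle point form a geometric sequence with
  ratio \<open>sqrt (\<eta> / \<rho>) < 1\<close>.
\<close>

lemma iterate_distance:
  "norm ((prev s, l s) - (xs, ls))
    \<le> norm ((xi, li) - (xs, ls)) + 2 * sqrt (\<epsilon>0 / \<beta>0) / (1 - sqrt (\<eta> / \<rho>))"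
proof -
  define r where "r = sqrt (\<eta> / \<rho>)"
  define b where "b = 2 * sqrt (\<epsilon>0 / \<beta>0)"
  have r: "0 \<le> r" "r < 1" using params by (auto simp: r_def)
  have b: "0 \<le> b" using params by (simp add: b_def)
  have inc: "sqrt (2 * e s / \<beta> s) \<le> b * r ^ s" for s
  proof -
    have "2 * e s / \<beta> s \<le> 4 * (\<epsilon>0 / \<beta>0) * (\<eta> / \<rho>) ^ s"
      using params by (simp add: e_def \<beta>_def power_divide field_simps)
    then have "sqrt (2 * e s / \<beta> s) \<le> sqrt (4 * (\<epsilon>0 / \<beta>0) * (\<eta> / \<rho>) ^ s)" by simp
    also have "\<dots> = b * r ^ s"
      unfolding b_def r_def real_sqrt_mult real_sqrt_power real_sqrt_four by simp
    finally show ?thesis .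
  qed
  have "norm ((prev s, l s) - (xs, ls)) \<le> norm ((xi, li) - (xs, ls)) + b * (\<Sum>t<s. r ^ t)"
  proof (induction s)
    case 0
    then show ?case by (simp add: run_facts(1))
  next
    case (Suc s)
    have "norm ((prev (Suc s), l (Suc s)) - (xs, ls))
        \<le> norm ((prev s, l s) - (xs, ls)) + sqrt (2 * e s / \<beta> s)"
      using near_min_contraction[OF x_near_min l_in beta_pos, of s]
      by (simp add: step_def run_facts(5))
    with Suc inc[of s] show ?case by (simp add: distrib_left)
  qed
  also have "b * (\<Sum>t<s. r ^ t) \<le> b * (1 / (1 - r))"
  proof (intro mult_left_mono b)
    have "(\<Sum>t<s. r ^ t) = (1 - r ^ s) / (1 - r)" using r by (simp add: sum_gp_strict)
    also have "\<dots> \<le> 1 / (1 - r)" using r by (intro divide_right_mono) auto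
    finally show "(\<Sum>t<s. r ^ t) \<le> 1 / (1 - r)" .
  qed
  finally show ?thesis by (simp add: b_def r_def)
qed

lemma iterate_bounds:
  "(norm (l s))\<^sup>2 \<le> c0" "(norm (prev s))\<^sup>2 \<le> c0" "(norm (prev s - xs))\<^sup>2 \<le> c0"
proof -
  define R where "R = norm ((xi, li) - (xs, ls)) + 2 * sqrt (\<epsilon>0 / \<beta>0) / (1 - sqrt (\<eta> / \<rho>))"
  have c0: "c0 = 2 * R\<^sup>2 + 2 * (norm ls)\<^sup>2 + 2 * (norm xs)\<^sup>2" by (simp add: const0_def R_def)
  have dist: "norm ((prev s, l s) - (xs, ls)) \<le> R" unfolding R_def by (rule iterate_distance)
  then have dx: "norm (prev s - xs) \<le> R" and dl: "norm (l s - ls) \<le> R"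
    using norm_fst_snd_le[of "(prev s, l s) - (xs, ls)"] by auto
  have sq: "(norm p)\<^sup>2 \<le> 2 * R\<^sup>2 + 2 * (norm q)\<^sup>2" if "norm (p - q) \<le> R" for p q :: "'c::real_inner"
  proof -
    have "norm p \<le> R + norm q" using that norm_triangle_sub[of p q] by simp
    then have "(norm p)\<^sup>2 \<le> (R + norm q)\<^sup>2" by (intro power_mono) auto
    also have "\<dots> \<le> 2 * R\<^sup>2 + 2 * (norm q)\<^sup>2"
      using zero_le_power2[of "R - norm q"] by (simp add: power2_eq_square algebra_simps)
    finally show ?thesis .
  qed
  show "(norm (l s))\<^sup>2 \<le> c0" "(norm (prev s))\<^sup>2 \<le> c0"
    using sq[OF dl] sq[OF dx] unfolding c0 by (smt (verit) zero_le_power2)+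
  have "(norm (prev s - xs))\<^sup>2 \<le> R\<^sup>2" using dx by (intro power_mono) auto
  then show "(norm (prev s - xs))\<^sup>2 \<le> c0" unfolding c0 by (smt (verit) zero_le_power2)
qed

lemma dual_solution_bound: "(norm ls)\<^sup>2 \<le> c0"
  unfolding const0_def by (smt (verit) zero_le_power2)

lemma iterate_norms:
  assumes B: "c0 \<le> B"
  shows "norm (l s) \<le> sqrt B" "norm (prev s) \<le> sqrt B" "norm ls \<le> sqrt B"
    "norm (l t - l s) \<le> 2 * sqrt B" "norm (prev t - prev s) \<le> 2 * sqrt B"
proof -
  have *: "norm (l s) \<le> sqrt B" "norm (prev s) \<le> sqrt B" "norm ls \<le> sqrt B" for s
    by (rule real_le_rsqrt, rule order_trans[OF _ B], rule iterate_bounds dual_solution_bound)+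
  then show "norm (l s) \<le> sqrt B" "norm (prev s) \<le> sqrt B" "norm ls \<le> sqrt B" by blast+
  show "norm (l t - l s) \<le> 2 * sqrt B" "norm (prev t - prev s) \<le> 2 * sqrt B"
    using *(1,2)[of s] *(1,2)[of t] norm_triangle_ineq4[of "l t" "l s"]
      norm_triangle_ineq4[of "prev t" "prev s"] by linarith+
qed

text \<open>
  All terms of \<open>M\<close> are \<open>\<beta>\<^sub>s\<close> times products of two bounded quantities. The only vector that does not belong
  to the sequence of iterates, the multiplier in the second term, is controlled by
  \<open>prox_restart_shift\<close>.
\<close>

lemma M_le:
  assumes B: "c0 \<le> B" "Lh\<^sup>2 \<le> B"
  shows "M s \<le> \<beta> s * (B * (16 + 2 / \<rho>\<^sup>2 + 4 / (2 * \<rho> - 1)))"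
proof -
  let ?b = "\<beta> s" and ?N = "norm (l (Suc s) - l s)"
  have B0: "0 \<le> B" using B(2) zero_le_power2[of Lh] by linarith
  have b: "0 < ?b" by (rule beta_pos)
  have \<rho>: "0 < \<rho>" "\<rho> < 1" "0 < 2 * \<rho> - 1" using params by auto
  note norms = iterate_norms[OF B(1)]
  have sq: "a\<^sup>2 \<le> 4 * B" if "0 \<le> a" "a \<le> 2 * sqrt B" for a
    using power_mono[OF that(2,1), of 2] B0 by (simp add: power_mult_distrib)
  have N2: "?N\<^sup>2 \<le> 4 * B" by (rule sq) (auto intro: norms)
  have t1: "?b * ?N\<^sup>2 \<le> ?b * (4 * B)" using N2 b by (intro mult_left_mono) auto
  have t2: "(?b - \<beta> (Suc s)) / 2 * (norm (Lam P (mul_A P (x s)) (l (Suc s)) (\<beta> (Suc s)) - l (Suc s)))\<^sup>2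
      \<le> ?b * (2 * B / \<rho>\<^sup>2)"
  proof -
    have "norm (Lam P (mul_A P (x s)) (l (Suc s)) (\<beta> (Suc s)) - l (Suc s)) \<le> ?b / \<beta> (Suc s) * ?N"
      by (rule prox_restart_shift[OF x_in l_in beta_pos beta_pos run_facts(5)])
    also have "\<dots> = ?N / \<rho>" unfolding beta_Suc using b by simp
    finally have "(norm (Lam P (mul_A P (x s)) (l (Suc s)) (\<beta> (Suc s)) - l (Suc s)))\<^sup>2 \<le> (?N / \<rho>)\<^sup>2"
      by (intro power_mono) auto
    also have "\<dots> \<le> 4 * B / \<rho>\<^sup>2" using N2 \<rho> by (simp add: power_divide divide_right_mono)
    finally have "(?b - \<beta> (Suc s)) / 2 * (norm (Lam P (mul_A P (x s)) (l (Suc s)) (\<beta> (Suc s)) - l (Suc s)))\<^sup>2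
        \<le> ?b / 2 * (4 * B / \<rho>\<^sup>2)"
      using b \<rho> B0 unfolding beta_Suc by (intro mult_mono) auto
    also have "?b / 2 * (4 * B / \<rho>\<^sup>2) = ?b * (2 * B / \<rho>\<^sup>2)" by simp
    finally show ?thesis .
  qed
  have t3: "?b\<^sup>2 / (2 * \<beta> (Suc s) - ?b) * (norm (prev s - x s))\<^sup>2 \<le> ?b * (4 * B / (2 * \<rho> - 1))"
  proof -
    have "?b\<^sup>2 / (2 * \<beta> (Suc s) - ?b) = ?b / (2 * \<rho> - 1)"
      unfolding beta_Suc using b \<rho> by (simp add: power2_eq_square field_simps)
    moreover have "?b / (2 * \<rho> - 1) * (norm (prev s - x s))\<^sup>2 \<le> ?b / (2 * \<rho> - 1) * (4 * B)"
      using norms(5)[of s "Suc s"] b \<rho> by (intro mult_left_mono sq) auto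
    ultimately show ?thesis by simp
  qed
  have scaled: "norm (?b *\<^sub>R p - \<beta> (Suc s) *\<^sub>R q) \<le> 2 * ?b * sqrt B"
    if "norm p \<le> sqrt B" "norm q \<le> sqrt B" for p q :: rvec
  proof -
    have "norm (?b *\<^sub>R p - \<beta> (Suc s) *\<^sub>R q) \<le> ?b * norm p + \<beta> (Suc s) * norm q"
      using norm_triangle_ineq4[of "?b *\<^sub>R p" "\<beta> (Suc s) *\<^sub>R q"] b beta_pos[of "Suc s"] by simp
    also have "\<dots> \<le> ?b * sqrt B + ?b * sqrt B"
      using that b \<rho> B0 beta_pos[of "Suc s"] unfolding beta_Suc by (intro add_mono mult_mono) auto
    also have "\<dots> = 2 * ?b * sqrt B" by simp
    finally show ?thesis .
  qed
  have parts: "norm (fst (l t)) \<le> sqrt B" "norm (snd (l t)) \<le> sqrt B" for t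
    using norm_fst_snd_le[of "l t"] norms(1)[of t] by linarith+
  have "Lh \<le> sqrt B" using B(2) by (rule real_le_rsqrt)
  then have "(?b + \<beta> (Suc s)) * Lh \<le> (?b + ?b) * sqrt B"
    using b \<rho> B0 Lh_nonneg beta_pos[of "Suc s"] unfolding beta_Suc by (intro mult_mono add_mono) auto
  then have u: "(?b + \<beta> (Suc s)) * Lh + norm (?b *\<^sub>R fst (l s) - \<beta> (Suc s) *\<^sub>R fst (l (Suc s)))
      \<le> 4 * ?b * sqrt B"
    using scaled[OF parts(1) parts(1), of s "Suc s"] by simp
  have "sqrt (((?b + \<beta> (Suc s)) * Lh + norm (?b *\<^sub>R fst (l s) - \<beta> (Suc s) *\<^sub>R fst (l (Suc s))))\<^sup>2
      + (norm (?b *\<^sub>R snd (l s) - \<beta> (Suc s) *\<^sub>R snd (l (Suc s))))\<^sup>2)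
      \<le> ((?b + \<beta> (Suc s)) * Lh + norm (?b *\<^sub>R fst (l s) - \<beta> (Suc s) *\<^sub>R fst (l (Suc s))))
        + norm (?b *\<^sub>R snd (l s) - \<beta> (Suc s) *\<^sub>R snd (l (Suc s)))"
    using b Lh_nonneg beta_pos[of "Suc s"] by (intro sqrt_sum_squares_le_sum) auto
  also have "\<dots> \<le> 4 * ?b * sqrt B + 2 * ?b * sqrt B"
    using u scaled[OF parts(2) parts(2), of s "Suc s"] by (rule add_mono)
  also have "\<dots> = 6 * ?b * sqrt B" by simp
  finally have "?N * sqrt (((?b + \<beta> (Suc s)) * Lh + norm (?b *\<^sub>R fst (l s) - \<beta> (Suc s) *\<^sub>R fst (l (Suc s))))\<^sup>2
      + (norm (?b *\<^sub>R snd (l s) - \<beta> (Suc s) *\<^sub>R snd (l (Suc s))))\<^sup>2) \<le> (2 * sqrt B) * (6 * ?b * sqrt B)"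
    using norms(4)[of "Suc s" s] B0 by (intro mult_mono) auto
  also have "\<dots> = ?b * (12 * B)" using B0 by simp
  finally have "M s \<le> ?b * (4 * B) + ?b * (2 * B / \<rho>\<^sup>2) + ?b * (4 * B / (2 * \<rho> - 1)) + ?b * (12 * B)"
    using t1 t2 t3 unfolding M_term_def by linarith
  also have "\<dots> = ?b * (B * (16 + 2 / \<rho>\<^sup>2 + 4 / (2 * \<rho> - 1)))"
    by (simp add: algebra_simps)
  finally show ?thesis .
qed

lemma accuracy:
  assumes B: "c0 \<le> B" "Lh\<^sup>2 \<le> B"
  shows "infdist (mul_A2 P (x s)) (K_of P) \<le> (\<epsilon>0 + 3 * \<beta>0 * B + 2 * \<beta>0 * sqrt B) * \<rho> ^ s"
    and "\<bar>real_of_ereal (objective P (x s) - opt_value P)\<bar> \<le> (\<epsilon>0 + 3 * \<beta>0 * B + 2 * \<beta>0 * sqrt B) * \<rho> ^ s"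
proof -
  let ?b = "\<beta> s" and ?N = "norm (l (Suc s) - l s)"
  have B0: "0 \<le> B" using B(2) zero_le_power2[of Lh] by linarith
  have b: "0 < ?b" by (rule beta_pos)
  note norms = iterate_norms[OF B(1)]
  note acc = near_min_accuracy[OF x_near_min l_in beta_pos run_facts(5), of s]
  have e: "e s \<le> \<epsilon>0 * \<rho> ^ s" using params by (simp add: e_def power_mono)
  have split: "(\<epsilon>0 + 3 * \<beta>0 * B + 2 * \<beta>0 * sqrt B) * \<rho> ^ s
      = \<epsilon>0 * \<rho> ^ s + ?b * (3 * B) + ?b * (2 * sqrt B)"
    by (simp add: \<beta>_def algebra_simps)
  have pos: "0 \<le> \<epsilon>0 * \<rho> ^ s" "0 \<le> ?b * (3 * B)" "0 \<le> ?b * (2 * sqrt B)" using params b B0 by auto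
  have N: "?b * ?N \<le> ?b * (2 * sqrt B)" using b norms(4) by (intro mult_left_mono) auto
  show "infdist (mul_A2 P (x s)) (K_of P) \<le> (\<epsilon>0 + 3 * \<beta>0 * B + 2 * \<beta>0 * sqrt B) * \<rho> ^ s"
    using acc(1) N pos unfolding split by linarith
  have product: "r * ?b * ?N \<le> ?b * (2 * B)" if "0 \<le> r" "r \<le> sqrt B" for r
  proof -
    have "r * (?b * ?N) \<le> sqrt B * (?b * (2 * sqrt B))" using that N b B0 by (intro mult_mono) auto
    also have "\<dots> = ?b * (2 * B)" using B0 by simp
    finally show ?thesis by (simp add: mult.assoc)
  qed
  have "Lh \<le> sqrt B" using B(2) by (rule real_le_rsqrt)
  then have p1: "Lh * ?b * ?N \<le> ?b * (2 * B)" by (intro product Lh_nonneg)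
  have p2: "?b * norm ls * ?N \<le> ?b * (2 * B)"
    using product[of "norm ls"] norms(3) by (simp add: mult.commute mult.left_commute)
  have "?b / 2 * (norm (xs - prev s))\<^sup>2 \<le> ?b / 2 * B" "?b / 2 * (norm (l s))\<^sup>2 \<le> ?b / 2 * B"
    using b order_trans[OF iterate_bounds(1)[of s] B(1)] order_trans[OF iterate_bounds(3)[of s] B(1)]
    by (simp_all add: norm_minus_commute)
  then show "\<bar>real_of_ereal (objective P (x s) - opt_value P)\<bar>
      \<le> (\<epsilon>0 + 3 * \<beta>0 * B + 2 * \<beta>0 * sqrt B) * \<rho> ^ s"
    using acc(2,3) p1 p2 e pos unfolding split objective_diff[OF x_in] by linarith
qed

text \<open>
  The required reduction factor grows at most like a constant times \<open>(\<rho> / \<eta>)\<^sup>s\<close>. Choosing \<open>N\<close> with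
  both factors below \<open>2\<^sup>N\<close> avoids logarithms: \<open>N (s + 1)\<close> restart periods suffice. As at least one
  period is run, rounding up at most doubles the count.
\<close>

lemma iteration_count:
  assumes B: "c0 \<le> B" "Lh\<^sup>2 \<le> B" and N: "0 < N"
    "4 / \<eta> + 2 * \<beta>0 * (B * (16 + 2 / \<rho>\<^sup>2 + 4 / (2 * \<rho> - 1))) / (\<epsilon>0 * \<eta>) \<le> 2 ^ N" "\<rho> / \<eta> \<le> 2 ^ N"
  shows "real (m (Suc s)) \<le> 2 * real N * real (Suc s) * \<kappa> (Suc s)"
proof -
  define D where "D = B * (16 + 2 / \<rho>\<^sup>2 + 4 / (2 * \<rho> - 1))"
  have ratio: "1 \<le> \<rho> / \<eta>" using params by simp
  have "2 * e s + M s \<le> 2 * (\<epsilon>0 * \<rho> ^ s) + (\<beta>0 * D) * \<rho> ^ s"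
  proof -
    have "e s \<le> \<epsilon>0 * \<rho> ^ s" using params by (simp add: e_def power_mono)
    moreover have "M s \<le> \<beta> s * D" using M_le[OF B] by (simp add: D_def)
    ultimately show ?thesis by (simp add: \<beta>_def mult.commute mult.left_commute)
  qed
  also have "\<dots> = (4 / \<eta> + 2 * \<beta>0 * D / (\<epsilon>0 * \<eta>)) * (\<rho> / \<eta>) ^ s * (e (Suc s) / 2)"
  proof -
    have h1: "(\<rho> / \<eta>) ^ s * \<eta> ^ s = \<rho> ^ s" using params by (simp add: power_divide)
    have h2: "(4 / \<eta> + 2 * \<beta>0 * D / (\<epsilon>0 * \<eta>)) * (\<epsilon>0 * \<eta> / 2) = 2 * \<epsilon>0 + \<beta>0 * D"
      using params by (simp add: field_simps)
    have h3: "p * r * (\<epsilon>0 * (\<eta> * \<eta> ^ s) / 2) = (p * (\<epsilon>0 * \<eta> / 2)) * (r * \<eta> ^ s)" for p r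
      by simp
    show ?thesis unfolding e_def power_Suc h3 h2 h1 by (simp add: distrib_right)
  qed
  also have "\<dots> \<le> 2 ^ N * (2 ^ N) ^ s * (e (Suc s) / 2)"
  proof (rule mult_right_mono)
    have "(\<rho> / \<eta>) ^ s \<le> (2 ^ N) ^ s" using N(3) ratio by (intro power_mono) linarith+
    then show "(4 / \<eta> + 2 * \<beta>0 * D / (\<epsilon>0 * \<eta>)) * (\<rho> / \<eta>) ^ s \<le> 2 ^ N * (2 ^ N) ^ s"
      using ratio by (intro mult_mono N(2)[folded D_def] zero_le_power) linarith+
  qed (use e_pos[of "Suc s"] in simp)
  also have "\<dots> = 2 ^ (N * Suc s) * e (Suc s) / 2"
    unfolding mult_Suc_right power_add power_mult by simp
  finally have "2 * e s + M s \<le> 2 ^ (N * Suc s) * e (Suc s) / 2" .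
  then have "real (m (Suc s)) \<le> \<kappa> (Suc s) * real (N * Suc s) + 1"
    unfolding run_facts(6) by (rule restart_count(2)[OF apg_facts(1) e_pos, rotated]) (use N(1) in simp)
  also have "1 \<le> \<kappa> (Suc s) * real (N * Suc s)"
  proof -
    have "1 \<le> N * Suc s" using N(1) by (cases N) auto
    then have "1 \<le> real (N * Suc s)" by (metis of_nat_1 of_nat_le_iff)
    then have "1 * 1 \<le> \<kappa> (Suc s) * real (N * Suc s)"
      using apg_facts(1)[of "Suc s"] by (intro mult_mono) auto
    then show ?thesis by simp
  qed
  finally show ?thesis by (simp add: algebra_simps)
qed

end

section \<open>The complexity bound\<close>

text \<open>
  Here \<open>b\<close> is the penalty parameter of the subproblem, and \<open>1/b\<close> is at most of order \<open>1/\<epsilon>\<close>. The factor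
  \<open>1 / (\<mu> + b)\<close> is bounded by \<open>1/\<mu>\<close> for \<open>\<mu> > 0\<close> and by \<open>1/b\<close> otherwise. The rate itself is at least one for
  small \<open>\<epsilon>\<close>, which absorbs the additive constants.
\<close>

lemma restart_period_le_rate:
  assumes pos: "0 < Lf" "0 \<le> \<mu>" "0 < b" "b \<le> \<beta>0" "0 < D" "0 < \<epsilon>" "\<epsilon> \<le> 1"
    and b: "1 / b \<le> D / \<epsilon>" and small: "\<epsilon> \<le> sqrt (Lf * \<beta>0 + nA\<^sup>2)"
    and \<kappa>: "\<kappa> \<le> 2 * sqrt (2 * (Lf + nA\<^sup>2 / b) / (\<mu> + b)) + 1"
  shows "1 \<le> apg_rate Lf \<beta>0 nA \<mu> \<epsilon>"
    and "\<kappa> \<le> (4 * D + 4 * sqrt D + 1) * apg_rate Lf \<beta>0 nA \<mu> \<epsilon>"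
proof -
  define Q where "Q = sqrt (Lf * \<beta>0 + nA\<^sup>2)"
  define R where "R = apg_rate Lf \<beta>0 nA \<mu> \<epsilon>"
  have "0 < Lf * \<beta>0" using pos by simp
  then have Q: "0 < Q" "Q\<^sup>2 = Lf * \<beta>0 + nA\<^sup>2" by (auto simp: Q_def intro: add_pos_nonneg)
  have D: "0 < sqrt D" "(sqrt D)\<^sup>2 = D" using pos by auto
  have "Lf + nA\<^sup>2 / b \<le> Q\<^sup>2 * (1 / b)"
  proof -
    have "Lf * b \<le> Lf * \<beta>0" using pos by simp
    then show ?thesis using pos Q(2) by (simp add: field_simps)
  qed
  also have "\<dots> \<le> Q\<^sup>2 * (D / \<epsilon>)" using b by (intro mult_left_mono) auto
  finally have num: "Lf + nA\<^sup>2 / b \<le> Q\<^sup>2 * (D / \<epsilon>)" .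
  have arg: "2 * (Lf + nA\<^sup>2 / b) / (\<mu> + b) \<le> 4 * (Q\<^sup>2 * (D / \<epsilon>)) * w" if w: "1 / (\<mu> + b) \<le> w" for w
  proof -
    have "(2 * (Lf + nA\<^sup>2 / b)) * (1 / (\<mu> + b)) \<le> (4 * (Q\<^sup>2 * (D / \<epsilon>))) * w"
    proof (rule mult_mono)
      have nonneg: "0 \<le> Q\<^sup>2 * (D / \<epsilon>)" using pos by simp
      have "2 * p \<le> 4 * q" if "p \<le> q" "0 \<le> q" for p q :: real using that by simp
      from this[OF num nonneg] show "2 * (Lf + nA\<^sup>2 / b) \<le> 4 * (Q\<^sup>2 * (D / \<epsilon>))" .
      show "0 \<le> 4 * (Q\<^sup>2 * (D / \<epsilon>))" using nonneg by simp
    qed (use pos w in auto)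
    then show ?thesis by simp
  qed
  have "1 \<le> R \<and> (\<kappa> \<le> 4 * D * R + R \<or> \<kappa> \<le> 4 * sqrt D * R + R)"
  proof (cases "\<mu> > 0")
    case True
    define q where "q = Q / sqrt (\<mu> * \<epsilon>)"
    have q: "0 \<le> q" using Q True pos by (simp add: q_def)
    have R: "R = q + 1 / sqrt \<epsilon>"
      using True pos by (simp add: R_def q_def apg_rate_def Q_def[symmetric] real_sqrt_mult add_divide_distrib)
    have "1 \<le> 1 / sqrt \<epsilon>" using pos by simp
    then have R1: "1 \<le> R" "q \<le> R" using R q by linarith+
    have "2 * (Lf + nA\<^sup>2 / b) / (\<mu> + b) \<le> 4 * (Q\<^sup>2 * (D / \<epsilon>)) * (1 / \<mu>)"
      using True pos by (intro arg) (simp add: field_simps)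
    also have "\<dots> = (2 * sqrt D * q)\<^sup>2"
      using True pos by (simp add: q_def power_mult_distrib power_divide mult.commute)
    finally have "sqrt (2 * (Lf + nA\<^sup>2 / b) / (\<mu> + b)) \<le> 2 * sqrt D * q"
      using D q by (intro real_le_lsqrt) auto
    also have "\<dots> \<le> 2 * sqrt D * R" using D R1 by (intro mult_left_mono) auto
    finally show ?thesis using \<kappa> R1 by auto
  next
    case False
    then have \<mu>: "\<mu> = 0" using pos by simp
    have R: "R = Q / \<epsilon>" by (simp add: R_def \<mu> apg_rate_def Q_def)
    have R1: "1 \<le> R" using small pos by (simp add: R Q_def)
    have "2 * (Lf + nA\<^sup>2 / b) / (\<mu> + b) \<le> 4 * (Q\<^sup>2 * (D / \<epsilon>)) * (D / \<epsilon>)"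
      using b by (intro arg) (simp add: \<mu>)
    also have "\<dots> = (2 * D * R)\<^sup>2" by (simp add: R power2_eq_square)
    finally have "sqrt (2 * (Lf + nA\<^sup>2 / b) / (\<mu> + b)) \<le> 2 * D * R"
      using pos R1 by (intro real_le_lsqrt) auto
    then show ?thesis using \<kappa> R1 by auto
  qed
  moreover from this have "0 \<le> 4 * D * R" "0 \<le> 4 * sqrt D * R" using D pos by auto
  ultimately show "1 \<le> R" "\<kappa> \<le> (4 * D + 4 * sqrt D + 1) * R"
    unfolding distrib_right mult_1 by linarith+
qed

text \<open>
  The first index at which \<open>c \<rho>\<^sup>s\<close> drops to \<open>\<epsilon>\<close> undershoots \<open>\<epsilon>\<close> by at most the factor \<open>\<rho>\<close>.
\<close>

lemma geometric_stopping_index: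
  fixes c \<rho> \<epsilon> :: real
  assumes \<rho>: "0 < \<rho>" "\<rho> < 1" and \<epsilon>: "0 < \<epsilon>" "\<epsilon> \<le> 1" "\<epsilon> < c"
  obtains s where "c * \<rho> ^ s \<le> \<epsilon>" "\<epsilon> * \<rho> \<le> c * \<rho> ^ s"
    "real s \<le> (1 + (\<bar>ln c\<bar> + 1) / ln (1 / \<rho>)) * (1 + ln (1 / \<epsilon>))"
proof -
  have c: "0 < c" using \<epsilon> by simp
  obtain k where "\<rho> ^ k < \<epsilon> / c" using real_arch_pow_inv[of "\<epsilon> / c" \<rho>] \<rho> \<epsilon> c by auto
  then have k: "c * \<rho> ^ k \<le> \<epsilon>" using c by (simp add: field_simps)
  define s where "s = (LEAST k. c * \<rho> ^ k \<le> \<epsilon>)"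
  have s: "c * \<rho> ^ s \<le> \<epsilon>" unfolding s_def using k by (rule LeastI)
  have "s \<noteq> 0" using s \<epsilon> by (cases s) auto
  then obtain n where n: "s = Suc n" using not0_implies_Suc by blast
  have big: "\<epsilon> < c * \<rho> ^ n"
    using not_less_Least[of n "\<lambda>k. c * \<rho> ^ k \<le> \<epsilon>"] n unfolding s_def by simp
  have lr: "0 < ln (1 / \<rho>)" using \<rho> by simp
  have "ln \<epsilon> < ln (c * \<rho> ^ n)" using big \<epsilon> by simp
  also have "\<dots> = ln c - real n * ln (1 / \<rho>)"
    using c \<rho> by (simp add: ln_mult ln_realpow ln_div)
  finally have "real n * ln (1 / \<rho>) \<le> \<bar>ln c\<bar> + ln (1 / \<epsilon>)" using \<epsilon> by (simp add: ln_div)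
  then have n_le: "real n \<le> (\<bar>ln c\<bar> + ln (1 / \<epsilon>)) / ln (1 / \<rho>)" using lr by (simp add: pos_le_divide_eq)
  have le: "0 \<le> ln (1 / \<epsilon>)" using \<epsilon> by simp
  have "\<bar>ln c\<bar> + ln (1 / \<epsilon>) \<le> (\<bar>ln c\<bar> + 1) * (1 + ln (1 / \<epsilon>))"
    using le by (simp add: algebra_simps)
  then have "real n \<le> (\<bar>ln c\<bar> + 1) / ln (1 / \<rho>) * (1 + ln (1 / \<epsilon>))"
    using n_le lr by (smt (verit) divide_right_mono times_divide_eq_left)
  then have "real s \<le> (1 + (\<bar>ln c\<bar> + 1) / ln (1 / \<rho>)) * (1 + ln (1 / \<epsilon>))"
    using le unfolding n by (simp add: distrib_right)
  moreover have "\<epsilon> * \<rho> \<le> c * \<rho> ^ s" using big \<rho> unfolding n by (simp add: mult.assoc[symmetric])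
  ultimately show ?thesis using s that by blast
qed

text \<open>
  The integral of a non-integrable function is zero by convention, which is
  below the nonnegative \<open>c\<close>.
\<close>

lemma (in prob_space) expectation_le_const:
  fixes f :: "'a \<Rightarrow> real"
  assumes "\<And>\<omega>. \<omega> \<in> space M \<Longrightarrow> f \<omega> \<le> c" "0 \<le> c"
  shows "expectation f \<le> c"
proof (cases "integrable M f")
  case True
  then show ?thesis using assms(1) by (intro integral_le_const) auto
qed (use assms(2) in \<open>simp add: not_integrable_integral_eq\<close>)

lemma (in prob_space) abs_expectation_le_const:
  fixes f :: "'a \<Rightarrow> real"
  assumes "\<And>\<omega>. \<omega> \<in> space M \<Longrightarrow> \<bar>f \<omega>\<bar> \<le> c" "0 \<le> c"
  shows "\<bar>expectation f\<bar> \<le> c"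
proof -
  have "\<bar>expectation f\<bar> \<le> expectation (\<lambda>\<omega>. \<bar>f \<omega>\<bar>)" by (rule integral_abs_bound)
  also have "\<dots> \<le> c" using assms by (rule expectation_le_const)
  finally show ?thesis .
qed

theorem corollary5:
  fixes c1 c2 \<rho> \<eta> \<beta>0 \<epsilon>0 :: real and m0 :: nat
  assumes "1 / 2 < \<rho>" "\<rho> < 1" "0 < \<eta>" "\<eta> < 1" "\<eta> < \<rho>" "0 < \<beta>0" "0 < \<epsilon>0" "0 < m0"
  shows "\<exists>C k :: real. 0 < C \<and> 0 < k \<and>
    (\<forall>(P :: problem) (Lh1 :: real) (Lf :: real) (\<mu>g :: real)
      (xs :: rvec) (ls :: rvec \<times> rvec) (xi :: rvec) (li :: rvec \<times> rvec)
      (\<kappa> :: nat \<Rightarrow> real) (\<Omega> :: (nat \<Rightarrow> real) measure) (\<A> :: (nat \<Rightarrow> real) \<Rightarrow> solver)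
      (x :: nat \<Rightarrow> (nat \<Rightarrow> real) \<Rightarrow> rvec) (l :: nat \<Rightarrow> (nat \<Rightarrow> real) \<Rightarrow> rvec \<times> rvec)
      (m :: nat \<Rightarrow> (nat \<Rightarrow> real) \<Rightarrow> nat).
        standing_assms P Lh1 \<and>
        0 < Lf \<and> quadratic_upper_bound P Lf \<and>
        0 \<le> \<mu>g \<and> strongly_convex_on (X_of P) \<mu>g (g_of P) \<and>
        primal_optimal P xs \<and> dual_optimal P ls \<and>
        xi \<in> dom_g P \<and> li \<in> dom_hconj P \<and>
        c1 = const1 Lh1 \<beta>0 \<epsilon>0 ls (const0 \<beta>0 \<rho> \<epsilon>0 \<eta> xi li xs ls) \<and>
        c2 = const2 Lh1 \<beta>0 \<rho> \<epsilon>0 \<eta> (const0 \<beta>0 \<rho> \<epsilon>0 \<eta> xi li xs ls) \<and>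
        prob_space \<Omega> \<and> (\<forall>s. x s \<in> borel_measurable \<Omega>) \<and>
        (\<forall>\<omega>\<in>space \<Omega>.
           ipalm_run P Lh1 (\<A> \<omega>) \<kappa> \<beta>0 \<rho> \<epsilon>0 \<eta> m0 xi li
             (\<lambda>s. x s \<omega>) (\<lambda>s. l s \<omega>) (\<lambda>s. m s \<omega>) \<and>
           apg_guarantee P Lf \<mu>g (\<A> \<omega>) \<kappa> \<beta>0 \<rho> xi (\<lambda>s. x s \<omega>) (\<lambda>s. l s \<omega>))
        \<longrightarrow>
        (\<forall>\<^sub>F \<epsilon> in at_right 0. \<exists>s.
           \<bar>prob_space.expectation \<Omega> (\<lambda>\<omega>. real_of_ereal (objective P (x s \<omega>) - opt_value P))\<bar> \<le> \<epsilon> \<and>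
           prob_space.expectation \<Omega> (\<lambda>\<omega>. infdist (mul_A2 P (x s \<omega>)) (K_of P)) \<le> \<epsilon> \<and>
           (\<Sum>t\<le>s. prob_space.expectation \<Omega> (\<lambda>\<omega>. real (m t \<omega>)))
             \<le> C * apg_rate Lf \<beta>0 (normA P) \<mu>g \<epsilon> * (1 + ln (1 / \<epsilon>)) powr k))"
proof -
  have \<rho>: "0 < \<rho>" using assms(1) by simp
  \<comment> \<open>The number \<open>B\<close> bounds both \<open>c\<^sub>0\<close> and the square of the Lipschitz constant of \<open>h\<^sub>1\<close>, since
    \<open>c\<^sub>1\<close> is at least \<open>\<epsilon>\<^sub>0 + 2 L\<^sub>h\<^sub>1\<^sup>2 \<beta>\<^sub>0 + c\<^sub>0 \<beta>\<^sub>0\<close>. All further constants depend on the problem through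
    \<open>B\<close> alone.\<close>
  define B where "B = \<bar>c1\<bar> / \<beta>0"
  define c where "c = \<epsilon>0 + 3 * \<beta>0 * B + 2 * \<beta>0 * sqrt B"
  define X where "X = 4 / \<eta> + 2 * \<beta>0 * (B * (16 + 2 / \<rho>\<^sup>2 + 4 / (2 * \<rho> - 1))) / (\<epsilon>0 * \<eta>)"
  obtain N where "max (max X (\<rho> / \<eta>)) 1 < (2 :: real) ^ N"
    using real_arch_pow[of 2 "max (max X (\<rho> / \<eta>)) 1"] by fastforce
  then have N: "X \<le> 2 ^ N" "\<rho> / \<eta> \<le> 2 ^ N" "0 < N" by (auto intro: Nat.gr0I)
  define D where "D = c / (\<beta>0 * \<rho>)"
  define G where "G = 4 * D + 4 * sqrt D + 1"
  define S where "S = 1 + (\<bar>ln c\<bar> + 1) / ln (1 / \<rho>)"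
  define C where "C = real m0 + 2 * real N * G * S\<^sup>2"
  have B0: "0 \<le> B" using assms(6) by (simp add: B_def)
  have c: "0 < c" using assms(6,7) B0 unfolding c_def by (intro add_pos_nonneg) auto
  have D: "0 < D" using c \<rho> assms(6) by (simp add: D_def)
  have G: "0 \<le> G" using D by (simp add: G_def)
  have C: "0 < C" using assms(8) G unfolding C_def by (intro add_pos_nonneg) auto
  show ?thesis
  proof (rule exI[of _ C], rule exI[of _ 2], intro conjI C allI impI, simp, elim conjE)
    fix P Lh1 Lf \<mu>g xs ls xi li \<kappa> and \<Omega> :: "(nat \<Rightarrow> real) measure" and \<A> x l m
    assume P: "standing_assms P Lh1" "primal_optimal P xs" "dual_optimal P ls"
      and xi: "xi \<in> dom_g P" "li \<in> dom_hconj P" and Lf: "0 < Lf" "0 \<le> \<mu>g"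
      and c1: "c1 = const1 Lh1 \<beta>0 \<epsilon>0 ls (const0 \<beta>0 \<rho> \<epsilon>0 \<eta> xi li xs ls)"
      and prob: "prob_space \<Omega>"
      and runs: "\<forall>\<omega>\<in>space \<Omega>.
           ipalm_run P Lh1 (\<A> \<omega>) \<kappa> \<beta>0 \<rho> \<epsilon>0 \<eta> m0 xi li
             (\<lambda>s. x s \<omega>) (\<lambda>s. l s \<omega>) (\<lambda>s. m s \<omega>) \<and>
           apg_guarantee P Lf \<mu>g (\<A> \<omega>) \<kappa> \<beta>0 \<rho> xi (\<lambda>s. x s \<omega>) (\<lambda>s. l s \<omega>)"
    interpret prob_space \<Omega> by (rule prob)
    let ?c0 = "const0 \<beta>0 \<rho> \<epsilon>0 \<eta> xi li xs ls"
    have bounds: "?c0 \<le> B" "Lh1\<^sup>2 \<le> B"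
    proof -
      have "\<epsilon>0 + 2 * Lh1\<^sup>2 * \<beta>0 + ?c0 * \<beta>0 \<le> c1" unfolding c1 const1_def by (intro Max_ge) auto
      moreover have "0 \<le> ?c0 * \<beta>0" "0 \<le> Lh1\<^sup>2 * \<beta>0" using assms(6) by (simp_all add: const0_def)
      ultimately have "?c0 * \<beta>0 \<le> \<bar>c1\<bar>" "Lh1\<^sup>2 * \<beta>0 \<le> \<bar>c1\<bar>" using assms(7) by linarith+
      then show "?c0 \<le> B" "Lh1\<^sup>2 \<le> B" using assms(6) by (simp_all add: B_def pos_le_divide_eq)
    qed
    have ipalm: "ipalm P Lh1 xs ls \<beta>0 \<rho> \<epsilon>0 \<eta> Lf \<mu>g m0 xi li \<kappa> (\<A> \<omega>)
        (\<lambda>s. x s \<omega>) (\<lambda>s. l s \<omega>) (\<lambda>s. m s \<omega>)" if "\<omega> \<in> space \<Omega>" for \<omega>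
      using P xi assms runs that
      by (auto intro!: ipalm.intro composite_problem.intro ipalm_axioms.intro)
    obtain \<omega>0 where \<omega>0: "\<omega>0 \<in> space \<Omega>" using not_empty by blast
    note \<kappa> = ipalm.apg_facts(1,2)[OF ipalm[OF \<omega>0], unfolded ipalm.\<beta>_def[OF ipalm[OF \<omega>0]]]
    let ?Q = "sqrt (Lf * \<beta>0 + (normA P)\<^sup>2)"
    define b where "b = min (min 1 c) ?Q"
    have "0 < Lf * \<beta>0" using Lf assms(6) by simp
    then have b: "0 < b" using c by (auto simp: b_def intro: add_pos_nonneg)
    show "\<forall>\<^sub>F \<epsilon> in at_right 0. \<exists>s.
           \<bar>expectation (\<lambda>\<omega>. real_of_ereal (objective P (x s \<omega>) - opt_value P))\<bar> \<le> \<epsilon> \<and>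
           expectation (\<lambda>\<omega>. infdist (mul_A2 P (x s \<omega>)) (K_of P)) \<le> \<epsilon> \<and>
           (\<Sum>t\<le>s. expectation (\<lambda>\<omega>. real (m t \<omega>)))
             \<le> C * apg_rate Lf \<beta>0 (normA P) \<mu>g \<epsilon> * (1 + ln (1 / \<epsilon>)) powr 2"
    proof (rule eventually_mono[OF eventually_at_right_real[OF b]])
      fix \<epsilon> assume "\<epsilon> \<in> {0<..<b}"
      then have \<epsilon>: "0 < \<epsilon>" "\<epsilon> \<le> 1" "\<epsilon> < c" "\<epsilon> \<le> ?Q" by (auto simp: b_def)
      obtain s where s: "c * \<rho> ^ s \<le> \<epsilon>" "\<epsilon> * \<rho> \<le> c * \<rho> ^ s" "real s \<le> S * (1 + ln (1 / \<epsilon>))"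
        unfolding S_def by (rule geometric_stopping_index[OF \<rho> assms(2) \<epsilon>(1-3)])
      let ?R = "apg_rate Lf \<beta>0 (normA P) \<mu>g \<epsilon>" and ?L = "1 + ln (1 / \<epsilon>)"
      have rate: "1 \<le> ?R \<and> \<kappa> t \<le> G * ?R" if "t \<le> s" for t
      proof -
        have "\<rho> ^ s \<le> \<rho> ^ t" using that \<rho> assms(2) by (intro power_decreasing) auto
        then have "\<epsilon> * \<rho> \<le> c * \<rho> ^ t" using s(2) c by (smt (verit) mult_left_mono)
        then have "1 / (\<beta>0 * \<rho> ^ t) \<le> D / \<epsilon>"
          using \<epsilon>(1) \<rho> assms(6) by (simp add: D_def field_simps)
        moreover have "0 < \<beta>0 * \<rho> ^ t" "\<beta>0 * \<rho> ^ t \<le> \<beta>0"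
          using \<rho> assms(2,6) by (simp_all add: power_le_one)
        ultimately show ?thesis
          unfolding G_def
          using restart_period_le_rate[OF Lf _ _ D \<epsilon>(1,2) _ \<epsilon>(4) \<kappa>(2)] by blast
      qed
      have L: "1 \<le> ?L" using \<epsilon> by simp
      have acc: "\<bar>real_of_ereal (objective P (x s \<omega>) - opt_value P)\<bar> \<le> \<epsilon>"
        "infdist (mul_A2 P (x s \<omega>)) (K_of P) \<le> \<epsilon>" if "\<omega> \<in> space \<Omega>" for \<omega>
        using ipalm.accuracy[OF ipalm[OF that] bounds, of s] s(1) unfolding c_def[symmetric] by linarith+
      have m_0: "expectation (\<lambda>\<omega>. real (m 0 \<omega>)) \<le> real m0"
        using ipalm.run_facts(2)[OF ipalm] by (intro expectation_le_const) auto
      have m_Suc: "expectation (\<lambda>\<omega>. real (m (Suc t) \<omega>)) \<le> 2 * real N * real s * (G * ?R)" if "t < s" for t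
      proof (rule expectation_le_const)
        fix \<omega> assume "\<omega> \<in> space \<Omega>"
        then have "real (m (Suc t) \<omega>) \<le> 2 * real N * real (Suc t) * \<kappa> (Suc t)"
          using ipalm.iteration_count[OF ipalm bounds N(3) N(1)[unfolded X_def] N(2)] by blast
        also have "\<dots> \<le> 2 * real N * real s * (G * ?R)"
          using that rate[of "Suc t"] \<kappa>(1)[of "Suc t"] by (intro mult_mono) auto
        finally show "real (m (Suc t) \<omega>) \<le> 2 * real N * real s * (G * ?R)" .
      qed (use G rate[of 0] in auto)
      have "(\<Sum>t\<le>s. expectation (\<lambda>\<omega>. real (m t \<omega>)))
          = expectation (\<lambda>\<omega>. real (m 0 \<omega>)) + (\<Sum>t<s. expectation (\<lambda>\<omega>. real (m (Suc t) \<omega>)))"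
        by (rule sum.atMost_shift)
      also have "\<dots> \<le> real m0 + real s * (2 * real N * real s * (G * ?R))"
        using sum_bounded_above[of "{..<s}" _ "2 * real N * real s * (G * ?R)"] m_Suc
        by (intro add_mono m_0) auto
      also have "\<dots> = real m0 + 2 * real N * G * ?R * (real s)\<^sup>2" by (simp add: power2_eq_square)
      also have "\<dots> \<le> real m0 * (?R * ?L\<^sup>2) + 2 * real N * G * ?R * (S * ?L)\<^sup>2"
      proof (intro add_mono)
        have "1 * 1 \<le> ?R * ?L\<^sup>2" using rate[of 0] L by (intro mult_mono one_le_power) auto
        then show "real m0 \<le> real m0 * (?R * ?L\<^sup>2)" by (simp add: mult_le_cancel_left1)
        show "2 * real N * G * ?R * (real s)\<^sup>2 \<le> 2 * real N * G * ?R * (S * ?L)\<^sup>2"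
          using s(3) G rate[of 0] by (intro mult_left_mono power_mono) auto
      qed
      also have "\<dots> = C * ?R * ?L\<^sup>2" unfolding C_def power_mult_distrib distrib_right by (simp only: ac_simps)
      also have "?L\<^sup>2 = ?L powr 2" using L by simp
      finally show "\<exists>s.
           \<bar>expectation (\<lambda>\<omega>. real_of_ereal (objective P (x s \<omega>) - opt_value P))\<bar> \<le> \<epsilon> \<and>
           expectation (\<lambda>\<omega>. infdist (mul_A2 P (x s \<omega>)) (K_of P)) \<le> \<epsilon> \<and>
           (\<Sum>t\<le>s. expectation (\<lambda>\<omega>. real (m t \<omega>))) \<le> C * ?R * ?L powr 2"
        using acc \<epsilon>(1) by (intro exI[of _ s] conjI abs_expectation_le_const expectation_le_const) auto
    qed
  qed
qed

end
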